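(* Let $V(r,\rho,\lambda)$ be a function on $(\mathcal A\times\mathcal B)\cap\{r>0,\rho>0\}$ of the form $$V(r,\rho,\lambda)=\sum_{i=1}^lA_i(\lambda)M_i\bigl(1+g_i(r,\rho,\lambda)\bigr),$$ where: 1. the leading monomials $M_i=r^{a_i}\rho^{b_i}\omega^{c_i}$ are general monomials without $\Omega$-factor (here $\omega=(\omega_j)_{j\in J}$, $c_i=(c_i^j)_{j\in J}$, $J$ a finite set, $\omega^{c_i}=\prod_{j\in J}\omega_j^{c_i^j}$); 2. the functions $g_i$ are $C^k$-functions on monomials, with $k\ge l$, and of order $o(1)$; 3. the functions $A_i(\lambda)$ are continuous; 4. the monomials $M_jM_i^{-1}$ for $i\ne j$ are non-resonant, i.e. $a_j^0-a_i^0-b_j^0+b_i^0\ne0$ for $i\neq j$, where $a_i^0=a_i(\lambda_0)$, $b_i^0=b_i(\lambda_0)$. Then, if $\mathcal A\times\mathcal B$ is chosen sufficiently small, for each $\lambda\in\mathcal B$: (i) either the function $V(\cdot,\cdot,\lambda)$ has at most $l-1$ isolated roots, counted with their multiplicity, on each curve $l_\nu=\{r\rho=\nu\}\subset\mathcal A$, $\nu>0$; (ii) or $V(\cdot,\cdot,\lambda)$ is identically zero.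
   Context: **Neighborhoods.** $r,\rho$ are variables in a compact rectangle $\mathcal A=[0,r_1]\times[0,\rho_1]$ (with $r_1<1$), and $\lambda$ is a multi-parameter in a compact neighborhood $\mathcal B$ of $\lambda_0$ in some Euclidean space. For $\nu>0$, $l_\nu=\{(r,\rho)\in\mathcal A: r\rho=\nu\}$. **Compensators.** $\omega_\gamma=\omega(r,\gamma)=\frac{r^{-\gamma}-1}{\gamma}$ if $\gamma\ne0$, and $-\ln r$ if $\gamma=0$. $\Omega_{\gamma_1,\gamma_2}=\frac{\omega_{\gamma_1}-\omega_{\gamma_2}}{\gamma_1-\gamma_2}$, extended by continuity to $\gamma_1=\gamma_2$. **Primary monomials.** Expressions of the form $r^a$, $\rho^b$, $r^a\omega_\gamma^{c}$, $r^a\Omega_{\gamma_1,\gamma_2}^d$ or $\omega_\gamma^{-e}$, where $a,b,c,d,e,\gamma,\gamma_1,\gamma_2$ are smooth functions of $\lambda$, with $a,b,e$ strictly positive and $\gamma(\lambda_0)=\gamma_1(\lambda_0)=\gamma_2(\lambda_0)=0$; they are extended by continuity to $r=0$ and vanish at $(0,0,\lambda_0)$. **$C^k$-functions on monomials.** A function $f(r,\rho,\lambda)$ on $\mathcal A\times\mathcal B$ such that there are primary monomials $m_1,\dots,m_s$ and a $C^k$-function $\tilde f(\xi_1,\dots,\xi_s,\lambda)$ on $\widetilde{\mathcal A}\times\mathcal B$, $\widetilde{\mathcal A}$ a neighborhood of $0\in\mathbb R^s$, with $f(r,\rho,\lambda)=\tilde f(m_1,\dots,m_s,\lambda)$. It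 is "of order $o(1)$" if $f(0,0,\lambda_0)=0$. **General monomials.** Expressions $M=r^a\rho^b\prod_i\omega_i^{c_i}\prod_j\Omega_j^{d_j}$ (finite products), where each $\omega_i$ is a compensator $\omega_{\gamma_i}=\omega(r,\gamma_i)$ (equal to $\frac{r^{-\gamma_i}-1}{\gamma_i}$ if $\gamma_i\ne0$ and to $-\ln r$ if $\gamma_i=0$) and each $\Omega_j$ is a compensator $\Omega_{\gamma_{j,1},\gamma_{j,2}}$ (equal to $\frac{\omega_{\gamma_{j,1}}-\omega_{\gamma_{j,2}}}{\gamma_{j,1}-\gamma_{j,2}}$, extended by continuity to $\gamma_{j,1}=\gamma_{j,2}$), and where $a,b,c_i,d_j$ and the internal parameters $\gamma_i,\gamma_{j,1},\gamma_{j,2}$ of the compensators are smooth functions of $\lambda$ (the exponents without any sign restriction), the internal parameters vanishing at $\lambda_0$. $M$ is resonant if $a(\lambda_0)=b(\lambda_0)$, and non-resonant otherwise. *)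

theory Defs
  imports "HOL-Analysis.Analysis"
begin

section \<open>Differentiability classes\<close>

text \<open>
  A function of several variables is of class $C^k$ on an open set if all its iterated partial
  derivatives up to order $k$ exist and are continuous there.
\<close>

primrec Ck_on :: "nat \<Rightarrow> 'p::euclidean_space set \<Rightarrow> ('p \<Rightarrow> real) \<Rightarrow> bool" where
  "Ck_on 0 W f \<longleftrightarrow> continuous_on W f"
| "Ck_on (Suc k) W f \<longleftrightarrow> continuous_on W f \<and>
     (\<forall>v\<in>Basis. (\<forall>x\<in>W. (\<lambda>t. f (x + t *\<^sub>R v)) field_differentiable at 0) \<and>
        Ck_on k W (\<lambda>x. deriv (\<lambda>t. f (x + t *\<^sub>R v)) 0))"

text \<open>On a set that is not open, smooth means: smooth on some open neighbourhood of it.\<close>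

definition smooth_on :: "'p::euclidean_space set \<Rightarrow> ('p \<Rightarrow> real) \<Rightarrow> bool" where
  "smooth_on B f \<longleftrightarrow> (\<exists>W. open W \<and> B \<subseteq> W \<and> (\<forall>k. Ck_on k W f))"

text \<open>
  The same for functions of $(\xi,\lambda) \in \mathbf{R}^s \times \mathbf{R}^p$ with variable $s$,
  where $\mathbf{R}^s$ is the carrier of \<^term>\<open>Euclidean_space s\<close>, i.e. the functions
  $\xi$ from the naturals to the reals with $\xi_i = 0$ for $i \ge s$ (coordinates are numbered
  from 0). The type of such functions carries the product topology, which induces the usual
  topology on that carrier.
\<close>

primrec Ck_on_prod :: "nat \<Rightarrow> nat \<Rightarrow> (nat \<Rightarrow> real) set \<Rightarrow> 'p::euclidean_space set \<Rightarrow>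
    ((nat \<Rightarrow> real) \<Rightarrow> 'p \<Rightarrow> real) \<Rightarrow> bool" where
  "Ck_on_prod 0 s U W F \<longleftrightarrow> continuous_on (U \<times> W) (\<lambda>(\<xi>, x). F \<xi> x)"
| "Ck_on_prod (Suc k) s U W F \<longleftrightarrow> continuous_on (U \<times> W) (\<lambda>(\<xi>, x). F \<xi> x) \<and>
     (\<forall>i<s. (\<forall>\<xi>\<in>U. \<forall>x\<in>W. (\<lambda>t. F (\<xi>(i := t)) x) field_differentiable at (\<xi> i)) \<and>
        Ck_on_prod k s U W (\<lambda>\<xi> x. deriv (\<lambda>t. F (\<xi>(i := t)) x) (\<xi> i))) \<and>
     (\<forall>v\<in>Basis. (\<forall>\<xi>\<in>U. \<forall>x\<in>W. (\<lambda>t. F \<xi> (x + t *\<^sub>R v)) field_differentiable at 0) \<and>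
        Ck_on_prod k s U W (\<lambda>\<xi> x. deriv (\<lambda>t. F \<xi> (x + t *\<^sub>R v)) 0))"

section \<open>Compensators and monomials\<close>

text \<open>
  The multi-parameter $\lambda$ is written \<open>x\<close> and its central value $\lambda_0$ is \<open>x0\<close>.
\<close>

definition omega :: "real \<Rightarrow> real \<Rightarrow> real" where
  "omega r \<gamma> = (if \<gamma> = 0 then - ln r else (r powr (- \<gamma>) - 1) / \<gamma>)"

text \<open>
  For $\gamma_1 = \gamma_2$ the extension by continuity of the difference quotient is the
  derivative of \<^term>\<open>omega r\<close>.
\<close>

definition Omega :: "real \<Rightarrow> real \<Rightarrow> real \<Rightarrow> real" where
  "Omega r \<gamma>1 \<gamma>2 =
     (if \<gamma>1 = \<gamma>2 then deriv (omega r) \<gamma>1 else (omega r \<gamma>1 - omega r \<gamma>2) / (\<gamma>1 - \<gamma>2))"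

text \<open>
  The expressions below are meaningful for $0 < r < 1$ (and \<open>\<rho> \<ge> 0\<close>), where both
  compensators are positive.
\<close>

inductive primary_expression :: "'p::euclidean_space set \<Rightarrow> 'p \<Rightarrow> (real \<Rightarrow> real \<Rightarrow> 'p \<Rightarrow> real) \<Rightarrow> bool"
  for B :: "'p set" and x0 :: 'p where
  "\<lbrakk>smooth_on B a; \<forall>x\<in>B. a x > 0\<rbrakk> \<Longrightarrow>
     primary_expression B x0 (\<lambda>r \<rho> x. r powr a x)"
| "\<lbrakk>smooth_on B b; \<forall>x\<in>B. b x > 0\<rbrakk> \<Longrightarrow>
     primary_expression B x0 (\<lambda>r \<rho> x. \<rho> powr b x)"
| "\<lbrakk>smooth_on B a; \<forall>x\<in>B. a x > 0; smooth_on B c; smooth_on B \<gamma>; \<gamma> x0 = 0\<rbrakk> \<Longrightarrow>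
     primary_expression B x0 (\<lambda>r \<rho> x. r powr a x * omega r (\<gamma> x) powr c x)"
| "\<lbrakk>smooth_on B a; \<forall>x\<in>B. a x > 0; smooth_on B d;
     smooth_on B \<gamma>1; smooth_on B \<gamma>2; \<gamma>1 x0 = 0; \<gamma>2 x0 = 0\<rbrakk> \<Longrightarrow>
     primary_expression B x0 (\<lambda>r \<rho> x. r powr a x * Omega r (\<gamma>1 x) (\<gamma>2 x) powr d x)"
| "\<lbrakk>smooth_on B e; \<forall>x\<in>B. e x > 0; smooth_on B \<gamma>; \<gamma> x0 = 0\<rbrakk> \<Longrightarrow>
     primary_expression B x0 (\<lambda>r \<rho> x. omega r (\<gamma> x) powr (- e x))"

text \<open>
  A primary monomial on $[0,r_1]\times[0,\rho_1]\times B$ is given by such an expression for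
  $r > 0$ and is extended to $r = 0$ by continuity.
\<close>

definition primary_monomial ::
  "real \<Rightarrow> real \<Rightarrow> 'p::euclidean_space set \<Rightarrow> 'p \<Rightarrow> (real \<Rightarrow> real \<Rightarrow> 'p \<Rightarrow> real) \<Rightarrow> bool" where
  "primary_monomial r1 \<rho>1 B x0 m \<longleftrightarrow>
     (\<exists>e. primary_expression B x0 e \<and>
        (\<forall>r\<in>{0<..r1}. \<forall>\<rho>\<in>{0..\<rho>1}. \<forall>x\<in>B. m r \<rho> x = e r \<rho> x)) \<and>
     continuous_on ({0..r1} \<times> {0..\<rho>1} \<times> B) (\<lambda>(r, \<rho>, x). m r \<rho> x) \<and>
     m 0 0 x0 = 0"

definition Ck_on_monomials ::
  "nat \<Rightarrow> real \<Rightarrow> real \<Rightarrow> 'p::euclidean_space set \<Rightarrow> 'p \<Rightarrow> (real \<Rightarrow> real \<Rightarrow> 'p \<Rightarrow> real) \<Rightarrow> bool" where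
  "Ck_on_monomials k r1 \<rho>1 B x0 f \<longleftrightarrow>
     (\<exists>s m U W F.
        (\<forall>i<s. primary_monomial r1 \<rho>1 B x0 (m i)) \<and>
        openin (Euclidean_space s) U \<and> (\<lambda>_. 0) \<in> U \<and> open W \<and> B \<subseteq> W \<and>
        Ck_on_prod k s U W F \<and>
        (\<forall>r\<in>{0..r1}. \<forall>\<rho>\<in>{0..\<rho>1}. \<forall>x\<in>B.
           (\<lambda>i. if i < s then m i r \<rho> x else 0) \<in> U \<and>
           f r \<rho> x = F (\<lambda>i. if i < s then m i r \<rho> x else 0) x))"

definition order_o1 :: "'p \<Rightarrow> (real \<Rightarrow> real \<Rightarrow> 'p \<Rightarrow> real) \<Rightarrow> bool" where
  "order_o1 x0 f \<longleftrightarrow> f 0 0 x0 = 0"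

definition general_monomial_omega ::
  "('p \<Rightarrow> real) \<Rightarrow> ('p \<Rightarrow> real) \<Rightarrow> 'j set \<Rightarrow> ('j \<Rightarrow> 'p \<Rightarrow> real) \<Rightarrow> ('j \<Rightarrow> 'p \<Rightarrow> real) \<Rightarrow>
    real \<Rightarrow> real \<Rightarrow> 'p \<Rightarrow> real" where
  "general_monomial_omega a b J \<gamma> c r \<rho> x =
     r powr a x * \<rho> powr b x * (\<Prod>j\<in>J. omega r (\<gamma> j x) powr c j x)"

section \<open>Isolated roots on the curves $r\rho = \nu$\<close>

definition l_curve :: "real \<Rightarrow> real \<Rightarrow> real \<Rightarrow> (real \<times> real) set" where
  "l_curve r1 \<rho>1 \<nu> = {(r, \<rho>). r \<in> {0..r1} \<and> \<rho> \<in> {0..\<rho>1} \<and> r * \<rho> = \<nu>}"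

definition isolated_roots :: "(real \<Rightarrow> real \<Rightarrow> real) \<Rightarrow> (real \<times> real) set \<Rightarrow> (real \<times> real) set" where
  "isolated_roots f C = {p. p isolated_in {(r, \<rho>) \<in> C. f r \<rho> = 0}}"

text \<open>
  The multiplicity is the number of leading derivatives of \<open>h\<close> that vanish at \<open>t\<close>; it is
  infinite if all of them vanish. It is only meant for functions \<open>h\<close> that are sufficiently often
  differentiable near \<open>t\<close>.
\<close>

definition root_multiplicity :: "(real \<Rightarrow> real) \<Rightarrow> real \<Rightarrow> enat" where
  "root_multiplicity h t = Sup {enat n |n. \<forall>j<n. (deriv ^^ j) h t = 0}"

text \<open>The curve $r\rho = \nu$ is parametrised by \<open>r\<close>.\<close>

definition at_most_roots_on_curve ::
  "nat \<Rightarrow> (real \<Rightarrow> real \<Rightarrow> real) \<Rightarrow> real \<Rightarrow> real \<Rightarrow> real \<Rightarrow> bool" where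
  "at_most_roots_on_curve N f r1 \<rho>1 \<nu> \<longleftrightarrow>
     finite (isolated_roots f (l_curve r1 \<rho>1 \<nu>)) \<and>
     (\<Sum>p\<in>isolated_roots f (l_curve r1 \<rho>1 \<nu>). root_multiplicity (\<lambda>r. f r (\<nu> / r)) (fst p)) \<le> enat N"

end

theory Submission
  imports Defs "HOL-Real_Asymp.Real_Asymp"
begin

text \<open>
  Along a curve $r\rho = \nu$, parametrised by $r$, the derivative $r\,d/dr$ is the Euler field
  $\theta = r\partial_r - \rho\partial_\rho$. A product $r^a\rho^b$ is an eigenfunction of
  $\theta$ with eigenvalue $a - b$. The compensators change so slowly that they do not disturb
  this to leading order: $\theta\omega_\gamma = -(1 + \gamma\omega_\gamma)$, so the
  logarithmic $\theta$-derivative of $\omega_\gamma$ is $-(\gamma + 1/\omega_\gamma)$, which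
  tends to 0 as $(r,\lambda) \to (0,\lambda_0)$. Functions on monomials of order $o(1)$ tend to
  0 together with their $\theta$-derivatives up to order $k$. Hence each term $h_i = M_i(1 + g_i)$ of $V$ has a
  logarithmic $\theta$-derivative with limit $\alpha_i = a_i^0 - b_i^0$, and non-resonance says
  that the numbers $\alpha_i$ are pairwise different.

  This is all that is needed for the classical division-derivation argument. If
  $H = \sum_i A_i h_i$ with $A_{i_0} \ne 0$, then $\theta(H/h_{i_0})$ is a combination, with the
  same coefficients, of the functions $\theta(h_i/h_{i_0})$ for $i \ne i_0$. Their logarithmic
  derivatives have the limits $\alpha_i - \alpha_{i_0}$, which are again pairwise different; the
  factor $\alpha_i - \alpha_{i_0} \ne 0$ guarantees that they do not vanish near the corner. By
  Rolle's theorem $H$ has at most one zero more than this shorter combination, so $l$ terms with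
  coefficients that are not all zero have at most $l - 1$ zeros, counted with multiplicity. The
  coefficients enter only through being nonzero, and therefore the neighbourhood of the corner
  depends neither on them nor on $\lambda$ and $\nu$. If all coefficients vanish at some
  $\lambda$, then $V$ is identically zero there.

  The bookkeeping is done by two classes of germs at the corner $(0,0,\lambda_0)$: \<open>tame\<close> functions
  (a limit exists, and iterated $\theta$-derivatives tend to 0) and \<open>log_tame\<close> functions
  (nonzero, with tame logarithmic $\theta$-derivative). The monomials and the functions
  $1 + g_i$ are \<open>log_tame\<close> by \<open>log_tame_general_monomial_omega\<close> and \<open>Ck_on_monomials_imp_tame\<close>; the induction on the number
  of terms is \<open>eventually_at_most_zeros_combination\<close>.
\<close>

section \<open>The Euler field near the corner\<close>

text \<open>
  This filter expresses ``after shrinking $\mathcal A\times\mathcal B$'': $r$ and $\rho$ are small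
  but positive, so that all powers and compensators are differentiable, whereas the parameter may
  be equal to its central value.
\<close>

definition corner :: "'p::metric_space \<Rightarrow> (real \<times> real \<times> 'p) filter" where
  "corner x0 = at_right 0 \<times>\<^sub>F at_right 0 \<times>\<^sub>F nhds x0"

definition on_curve :: "real \<times> real \<times> 'p \<Rightarrow> real \<Rightarrow> real \<times> real \<times> 'p" where
  "on_curve z t = (t, fst z * fst (snd z) / t, snd (snd z))"

text \<open>
  The derivative of \<open>f\<close> at \<open>z\<close> along the field $r\partial_r - \rho\partial_\rho$, which is $r$
  times the derivative with respect to the curve parameter $r$.
\<close>

definition euler_deriv :: "(real \<times> real \<times> 'p \<Rightarrow> real) \<Rightarrow> real \<times> real \<times> 'p \<Rightarrow> real \<Rightarrow> bool" where
  "euler_deriv f z d \<longleftrightarrow> ((\<lambda>t. f (on_curve z t)) has_real_derivative d / fst z) (at (fst z))"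

lemma eventually_corner:
  "eventually P (corner x0) \<longleftrightarrow>
     (\<exists>\<delta>>0. \<forall>r \<rho> x. 0 < r \<and> r < \<delta> \<and> 0 < \<rho> \<and> \<rho> < \<delta> \<and> dist x x0 < \<delta> \<longrightarrow> P (r, \<rho>, x))"
  (is "_ \<longleftrightarrow> ?R")
proof
  assume "eventually P (corner x0)"
  then obtain P1 P2 P3 where ev: "eventually P1 (at_right (0::real))" "eventually P2 (at_right (0::real))"
      "eventually P3 (nhds x0)" and P: "\<And>r \<rho> x. P1 r \<Longrightarrow> P2 \<rho> \<Longrightarrow> P3 x \<Longrightarrow> P (r, \<rho>, x)"
    unfolding corner_def eventually_prod_filter by blast
  obtain d1 where d1: "d1 > 0" "\<And>r. 0 < r \<Longrightarrow> r < d1 \<Longrightarrow> P1 r"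
    using ev(1) unfolding eventually_at_right_field by auto
  obtain d2 where d2: "d2 > 0" "\<And>r. 0 < r \<Longrightarrow> r < d2 \<Longrightarrow> P2 r"
    using ev(2) unfolding eventually_at_right_field by auto
  obtain d3 where d3: "d3 > 0" "\<And>x. dist x x0 < d3 \<Longrightarrow> P3 x"
    using ev(3) unfolding eventually_nhds_metric by auto
  show ?R
    by (rule exI[of _ "min d1 (min d2 d3)"]) (use d1 d2 d3 P in auto)
next
  assume ?R
  then obtain d where d: "d > 0" "\<And>r \<rho> x. 0 < r \<Longrightarrow> r < d \<Longrightarrow> 0 < \<rho> \<Longrightarrow> \<rho> < d \<Longrightarrow> dist x x0 < d \<Longrightarrow> P (r, \<rho>, x)"
    by blast
  have e: "eventually (\<lambda>r. 0 < r \<and> r < d) (at_right 0)"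
    using d(1) unfolding eventually_at_right_field by auto
  moreover have "eventually (\<lambda>x. dist x x0 < d) (nhds x0)"
    using d(1) unfolding eventually_nhds_metric by auto
  ultimately have "\<forall>\<^sub>F z in corner x0. 0 < fst z \<and> fst z < d"
      "\<forall>\<^sub>F z in corner x0. 0 < fst (snd z) \<and> fst (snd z) < d"
      "\<forall>\<^sub>F z in corner x0. dist (snd (snd z)) x0 < d"
    using eventually_compose_filterlim[OF e filterlim_fst]
      eventually_compose_filterlim[OF e filterlim_compose[OF filterlim_fst filterlim_snd]]
      eventually_compose_filterlim[OF _ filterlim_compose[OF filterlim_snd filterlim_snd]]
    unfolding corner_def by blast+
  then show "eventually P (corner x0)"
    by eventually_elim (use d(2) in auto)
qed

lemma eventually_corner_positive: "\<forall>\<^sub>F z in corner x0. 0 < fst z \<and> fst z < 1 \<and> 0 < fst (snd z)"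
  unfolding eventually_corner by (rule exI[of _ 1]) auto

lemma corner_le_nhds: "corner x0 \<le> nhds (0, 0, x0)"
  unfolding corner_def nhds_prod by (intro prod_filter_mono at_within_le_nhds order_refl)

lemma tendsto_param_corner: "((\<lambda>z. snd (snd z)) \<longlongrightarrow> x0) (corner x0)"
  unfolding corner_def
  by (rule filterlim_compose[OF filterlim_snd filterlim_snd])

lemma on_curve_self: "fst z \<noteq> 0 \<Longrightarrow> on_curve z (fst z) = z"
  by (cases z) (simp add: on_curve_def)

lemma on_curve_on_curve: "t \<noteq> 0 \<Longrightarrow> on_curve (on_curve z t) s = on_curve z s"
  by (simp add: on_curve_def)

text \<open>
  The corner neighbourhoods are open, so a property of germs also holds on a piece of the curve
  through a point. This makes it possible to differentiate identities between germs.
\<close>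

lemma eventually_corner_along_curve:
  assumes "eventually P (corner x0)"
  shows "\<forall>\<^sub>F z in corner x0. \<forall>\<^sub>F t in nhds (fst z). P (on_curve z t)"
proof -
  obtain d where d: "d > 0" "\<And>r \<rho> x. 0 < r \<Longrightarrow> r < d \<Longrightarrow> 0 < \<rho> \<Longrightarrow> \<rho> < d \<Longrightarrow> dist x x0 < d \<Longrightarrow> P (r, \<rho>, x)"
    using assms unfolding eventually_corner by blast
  have "\<forall>\<^sub>F t in nhds r. P (on_curve (r, \<rho>, x) t)"
    if *: "0 < r" "r < d" "0 < \<rho>" "\<rho> < d" "dist x x0 < d" for r \<rho> x
  proof -
    have lim: "((\<lambda>t. r * \<rho> / t) \<longlongrightarrow> r * \<rho> / r) (nhds r)"
      using * by (intro tendsto_intros) (auto simp: filterlim_ident)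
    have "\<forall>\<^sub>F t in nhds r. r * \<rho> / t < d" "\<forall>\<^sub>F t in nhds r. 0 < r * \<rho> / t"
      using * order_tendstoD[OF lim] by auto
    moreover have "\<forall>\<^sub>F t in nhds r. t > 0" "\<forall>\<^sub>F t in nhds r. t < d"
      using * by (auto intro: order_tendstoD[OF filterlim_ident])
    ultimately show ?thesis
      by eventually_elim (use * d in \<open>auto simp: on_curve_def\<close>)
  qed
  then show ?thesis
    unfolding eventually_corner by (intro exI[of _ d]) (use d(1) in auto)
qed

lemma euler_deriv_cong:
  assumes "\<forall>\<^sub>F t in nhds (fst z). f (on_curve z t) = g (on_curve z t)" "euler_deriv f z d"
  shows "euler_deriv g z d"
  using assms(2) DERIV_cong_ev[OF refl assms(1) refl, of "d / fst z"] unfolding euler_deriv_def by simp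

lemma euler_deriv_param: "euler_deriv (\<lambda>z. c (snd (snd z))) z 0"
  by (simp add: euler_deriv_def on_curve_def)

lemma euler_deriv_add:
  assumes "euler_deriv f z d" "euler_deriv g z e"
  shows "euler_deriv (\<lambda>z. f z + g z) z (d + e)"
  using DERIV_add[OF assms[unfolded euler_deriv_def]] by (simp add: euler_deriv_def add_divide_distrib)

lemma euler_deriv_mult:
  assumes "fst z \<noteq> 0" "euler_deriv f z d" "euler_deriv g z e"
  shows "euler_deriv (\<lambda>z. f z * g z) z (d * g z + f z * e)"
  using DERIV_mult[OF assms(2,3)[unfolded euler_deriv_def]]
  by (simp add: euler_deriv_def add_divide_distrib on_curve_self assms(1) mult_ac add_ac)

lemma euler_deriv_inverse:
  assumes "fst z \<noteq> 0" "euler_deriv f z d" "f z \<noteq> 0"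
  shows "euler_deriv (\<lambda>z. inverse (f z)) z (- d * inverse (f z) * inverse (f z))"
  using DERIV_inverse'[OF assms(2)[unfolded euler_deriv_def]]
  by (simp add: euler_deriv_def on_curve_self assms mult_ac divide_inverse)

lemma euler_deriv_powr:
  assumes "fst z \<noteq> 0" "euler_deriv f z d" "f z > 0"
  shows "euler_deriv (\<lambda>z. f z powr c (snd (snd z))) z (f z powr c (snd (snd z)) * (c (snd (snd z)) * (d / f z)))"
proof -
  have "((\<lambda>t. f (on_curve z t) powr c (snd (snd z))) has_real_derivative
      c (snd (snd z)) * f z powr (c (snd (snd z)) - 1) * (d / fst z)) (at (fst z))"
    using DERIV_fun_powr[OF assms(2)[unfolded euler_deriv_def], of "c (snd (snd z))"] assms
    by (simp add: on_curve_self)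
  moreover have "f z powr (c (snd (snd z)) - 1) = f z powr c (snd (snd z)) / f z"
    using assms(3) by (simp add: powr_diff)
  moreover have "snd (snd (on_curve z t)) = snd (snd z)" for t
    by (simp add: on_curve_def)
  ultimately show ?thesis
    by (simp add: euler_deriv_def mult_ac)
qed

lemma euler_deriv_r: "fst z \<noteq> 0 \<Longrightarrow> euler_deriv fst z (fst z)"
  by (simp add: euler_deriv_def on_curve_def)

lemma euler_deriv_rho: "fst z \<noteq> 0 \<Longrightarrow> euler_deriv (\<lambda>z. fst (snd z)) z (- fst (snd z))"
  unfolding euler_deriv_def on_curve_def
  by (auto intro!: derivative_eq_intros simp: divide_simps power2_eq_square)

lemma euler_deriv_radial:
  assumes "((\<lambda>r. h r (snd (snd z))) has_real_derivative d / fst z) (at (fst z))"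
  shows "euler_deriv (\<lambda>z. h (fst z) (snd (snd z))) z d"
  using assms by (simp add: euler_deriv_def on_curve_def)

section \<open>Functions with small Euler derivatives\<close>

text \<open>
  The $\theta$-derivatives are required to tend to 0, and not only to stay bounded. This is what
  makes the logarithmic derivative of a function with nonzero limit tend to 0. The requirement is
  met by $C^k$ functions of primary monomials, since primary monomials tend to 0 together with their
  $\theta$-derivatives.
\<close>

primrec tame :: "'p::metric_space \<Rightarrow> nat \<Rightarrow> (real \<times> real \<times> 'p \<Rightarrow> real) \<Rightarrow> real \<Rightarrow> bool" where
  "tame x0 0 f L \<longleftrightarrow> (f \<longlongrightarrow> L) (corner x0)"
| "tame x0 (Suc k) f L \<longleftrightarrow> (f \<longlongrightarrow> L) (corner x0) \<and>
     (\<exists>f'. (\<forall>\<^sub>F z in corner x0. euler_deriv f z (f' z)) \<and> tame x0 k f' 0)"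

lemma tame_imp_tendsto: "tame x0 k f L \<Longrightarrow> (f \<longlongrightarrow> L) (corner x0)"
  by (cases k) auto

lemma tame_Suc_imp_tame: "tame x0 (Suc k) f L \<Longrightarrow> tame x0 k f L"
  by (induction k arbitrary: f L) auto

lemma tame_antimono: "k \<le> n \<Longrightarrow> tame x0 n f L \<Longrightarrow> tame x0 k f L"
  by (induction n rule: dec_induct) (auto dest: tame_Suc_imp_tame simp del: tame.simps)

lemma tame_cong:
  assumes "\<forall>\<^sub>F z in corner x0. f z = g z" "tame x0 k f L"
  shows "tame x0 k g L"
proof -
  have lim: "(g \<longlongrightarrow> L) (corner x0)"
    using Lim_transform_eventually[OF tame_imp_tendsto[OF assms(2)] assms(1)] .
  show ?thesis
  proof (cases k)
    case (Suc n)
    then obtain f' where f': "\<forall>\<^sub>F z in corner x0. euler_deriv f z (f' z)" "tame x0 n f' 0"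
      using assms(2) by auto
    have "\<forall>\<^sub>F z in corner x0. euler_deriv g z (f' z)"
      using f'(1) eventually_corner_along_curve[OF assms(1)] eventually_corner_positive
      by eventually_elim (rule euler_deriv_cong)
    with f' lim Suc show ?thesis by auto
  qed (use lim in auto)
qed

text \<open>
  The parameter is constant along the curves, so continuity in it suffices.
\<close>

lemma tame_param:
  assumes "(c \<longlongrightarrow> L) (nhds x0)"
  shows "tame x0 k (\<lambda>z. c (snd (snd z))) L"
proof -
  have lim: "((\<lambda>z. c (snd (snd z))) \<longlongrightarrow> L) (corner x0)"
    by (rule filterlim_compose[OF assms tendsto_param_corner])
  have zero: "tame x0 k (\<lambda>_. 0) 0" for k
    by (induction k) (auto intro!: exI[of _ "\<lambda>_. 0"] simp: euler_deriv_def)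
  show ?thesis
    using lim zero by (cases k) (auto intro!: exI[of _ "\<lambda>_. 0"] always_eventually euler_deriv_param)
qed

lemma tame_const: "tame x0 k (\<lambda>_. c) c"
  using tame_param[of "\<lambda>_. c" c] by simp

lemma tame_add:
  "tame x0 k f L \<Longrightarrow> tame x0 k g M \<Longrightarrow> tame x0 k (\<lambda>z. f z + g z) (L + M)"
proof (induction k arbitrary: f g L M)
  case (Suc k)
  then obtain f' g' where fg: "\<forall>\<^sub>F z in corner x0. euler_deriv f z (f' z)" "tame x0 k f' 0"
     "\<forall>\<^sub>F z in corner x0. euler_deriv g z (g' z)" "tame x0 k g' 0" by auto
  have "\<forall>\<^sub>F z in corner x0. euler_deriv (\<lambda>z. f z + g z) z (f' z + g' z)"
    using fg(1,3) by eventually_elim (rule euler_deriv_add)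
  moreover have "tame x0 k (\<lambda>z. f' z + g' z) (0 + 0)"
    using fg by (intro Suc.IH)
  ultimately show ?case
    using Suc.prems by (auto intro!: tendsto_add)
qed (auto intro: tendsto_add)

lemma tame_mult:
  "tame x0 k f L \<Longrightarrow> tame x0 k g M \<Longrightarrow> tame x0 k (\<lambda>z. f z * g z) (L * M)"
proof (induction k arbitrary: f g L M)
  case (Suc k)
  then obtain f' g' where fg: "\<forall>\<^sub>F z in corner x0. euler_deriv f z (f' z)" "tame x0 k f' 0"
     "\<forall>\<^sub>F z in corner x0. euler_deriv g z (g' z)" "tame x0 k g' 0" by auto
  have "\<forall>\<^sub>F z in corner x0. euler_deriv (\<lambda>z. f z * g z) z (f' z * g z + f z * g' z)"
    using fg(1,3) eventually_corner_positive by eventually_elim (rule euler_deriv_mult, auto)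
  moreover have "tame x0 k (\<lambda>z. f' z * g z + f z * g' z) (0 * M + L * 0)"
    by (intro tame_add Suc.IH fg tame_Suc_imp_tame[OF Suc.prems(1)] tame_Suc_imp_tame[OF Suc.prems(2)])
  ultimately show ?case
    using Suc.prems by (auto intro!: tendsto_mult)
qed (auto intro: tendsto_mult)

lemma tame_uminus: "tame x0 k f L \<Longrightarrow> tame x0 k (\<lambda>z. - f z) (- L)"
  using tame_mult[OF tame_const[of x0 k "-1"]] by fastforce

lemma tame_diff: "tame x0 k f L \<Longrightarrow> tame x0 k g M \<Longrightarrow> tame x0 k (\<lambda>z. f z - g z) (L - M)"
  using tame_add[OF _ tame_uminus] by fastforce

lemma tame_sum:
  assumes "finite I" "\<And>i. i \<in> I \<Longrightarrow> tame x0 k (f i) (L i)"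
  shows "tame x0 k (\<lambda>z. \<Sum>i\<in>I. f i z) (\<Sum>i\<in>I. L i)"
  using assms by (induction I rule: finite_induct) (simp_all add: tame_const tame_add)

lemma tame_inverse:
  assumes "L \<noteq> 0"
  shows "tame x0 k f L \<Longrightarrow> tame x0 k (\<lambda>z. inverse (f z)) (inverse L)"
proof (induction k)
  case (Suc k)
  then obtain f' where f': "\<forall>\<^sub>F z in corner x0. euler_deriv f z (f' z)" "tame x0 k f' 0" by auto
  have "\<forall>\<^sub>F z in corner x0. f z \<noteq> 0"
    using Suc.prems assms by (auto intro: tendsto_imp_eventually_ne)
  then have "\<forall>\<^sub>F z in corner x0. euler_deriv (\<lambda>z. inverse (f z)) z (- f' z * inverse (f z) * inverse (f z))"
    using f'(1) eventually_corner_positive by eventually_elim (rule euler_deriv_inverse, auto)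
  moreover have "tame x0 k (\<lambda>z. - f' z * inverse (f z) * inverse (f z)) (- 0 * inverse L * inverse L)"
    by (intro tame_mult tame_uminus f' Suc.IH tame_Suc_imp_tame[OF Suc.prems])
  ultimately show ?case
    using Suc.prems assms by (auto intro!: tendsto_inverse)
qed (use assms in \<open>auto intro: tendsto_inverse\<close>)

text \<open>
  The function itself may be unbounded or tend to 0 arbitrarily fast; only its logarithmic
  derivative is controlled. The exponent $\alpha$ is additive in products, and such a function has
  one more derivative than its logarithmic derivative.
\<close>

definition log_tame :: "'p::metric_space \<Rightarrow> nat \<Rightarrow> (real \<times> real \<times> 'p \<Rightarrow> real) \<Rightarrow> real \<Rightarrow> bool" where
  "log_tame x0 k h \<alpha> \<longleftrightarrow>
     (\<exists>p. tame x0 k p \<alpha> \<and> (\<forall>\<^sub>F z in corner x0. h z \<noteq> 0 \<and> euler_deriv h z (h z * p z)))"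

lemma log_tame_mult:
  assumes "log_tame x0 k f \<alpha>" "log_tame x0 k g \<beta>"
  shows "log_tame x0 k (\<lambda>z. f z * g z) (\<alpha> + \<beta>)"
proof -
  obtain p q where p: "tame x0 k p \<alpha>" "\<forall>\<^sub>F z in corner x0. f z \<noteq> 0 \<and> euler_deriv f z (f z * p z)"
    and q: "tame x0 k q \<beta>" "\<forall>\<^sub>F z in corner x0. g z \<noteq> 0 \<and> euler_deriv g z (g z * q z)"
    using assms unfolding log_tame_def by blast
  have "\<forall>\<^sub>F z in corner x0. f z * g z \<noteq> 0 \<and> euler_deriv (\<lambda>z. f z * g z) z ((f z * g z) * (p z + q z))"
    using p(2) q(2) eventually_corner_positive
  proof eventually_elim
    case (elim z)
    then show ?case
      using euler_deriv_mult[of z f "f z * p z" g "g z * q z"] by (simp add: algebra_simps)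
  qed
  with tame_add[OF p(1) q(1)] show ?thesis
    unfolding log_tame_def by blast
qed

lemma log_tame_inverse:
  assumes "log_tame x0 k f \<alpha>"
  shows "log_tame x0 k (\<lambda>z. inverse (f z)) (- \<alpha>)"
proof -
  obtain p where p: "tame x0 k p \<alpha>" "\<forall>\<^sub>F z in corner x0. f z \<noteq> 0 \<and> euler_deriv f z (f z * p z)"
    using assms unfolding log_tame_def by blast
  have "\<forall>\<^sub>F z in corner x0. inverse (f z) \<noteq> 0 \<and> euler_deriv (\<lambda>z. inverse (f z)) z (inverse (f z) * (- p z))"
    using p(2) eventually_corner_positive
  proof eventually_elim
    case (elim z)
    then show ?case
      using euler_deriv_inverse[of z f "f z * p z"] by (simp add: field_simps)
  qed
  with tame_uminus[OF p(1)] show ?thesis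
    unfolding log_tame_def by blast
qed

lemma log_tame_powr:
  assumes "log_tame x0 k f \<alpha>" "\<forall>\<^sub>F z in corner x0. f z > 0" "(c \<longlongrightarrow> c0) (nhds x0)"
  shows "log_tame x0 k (\<lambda>z. f z powr c (snd (snd z))) (c0 * \<alpha>)"
proof -
  obtain p where p: "tame x0 k p \<alpha>" "\<forall>\<^sub>F z in corner x0. f z \<noteq> 0 \<and> euler_deriv f z (f z * p z)"
    using assms unfolding log_tame_def by blast
  have "\<forall>\<^sub>F z in corner x0. f z powr c (snd (snd z)) \<noteq> 0 \<and> euler_deriv (\<lambda>z. f z powr c (snd (snd z))) z
     (f z powr c (snd (snd z)) * (c (snd (snd z)) * p z))"
    using p(2) assms(2) eventually_corner_positive
  proof eventually_elim
    case (elim z)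
    then show ?case
      using euler_deriv_powr[of z f "f z * p z" c] by simp
  qed
  with tame_mult[OF tame_param[OF assms(3)] p(1)] show ?thesis
    unfolding log_tame_def by blast
qed

lemma log_tame_prod:
  assumes "finite I" "\<And>i. i \<in> I \<Longrightarrow> log_tame x0 k (f i) (\<alpha> i)"
  shows "log_tame x0 k (\<lambda>z. \<Prod>i\<in>I. f i z) (\<Sum>i\<in>I. \<alpha> i)"
  using assms
proof (induction I rule: finite_induct)
  case empty
  have "log_tame x0 k (\<lambda>_. 1) 0"
    unfolding log_tame_def using tame_const[of x0 k 0] by (intro exI[of _ "\<lambda>_. 0"]) (simp add: euler_deriv_def)
  then show ?case by simp
qed (simp add: log_tame_mult)

text \<open>
  The logarithmic derivative $f'/f$ tends to 0 because $f'$ does and $f$ has a nonzero limit.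
\<close>

lemma tame_imp_log_tame:
  assumes "tame x0 (Suc k) f L" "L \<noteq> 0"
  shows "log_tame x0 k f 0"
proof -
  obtain f' where f': "\<forall>\<^sub>F z in corner x0. euler_deriv f z (f' z)" "tame x0 k f' 0"
    using assms by auto
  have "tame x0 k (\<lambda>z. f' z * inverse (f z)) (0 * inverse L)"
    by (intro tame_mult tame_inverse f' assms(2) tame_Suc_imp_tame[OF assms(1)])
  moreover have "\<forall>\<^sub>F z in corner x0. f z \<noteq> 0"
    using assms by (auto intro: tendsto_imp_eventually_ne)
  then have "\<forall>\<^sub>F z in corner x0. f z \<noteq> 0 \<and> euler_deriv f z (f z * (f' z * inverse (f z)))"
    using f'(1) by eventually_elim (simp add: field_simps)
  ultimately show ?thesis
    unfolding log_tame_def by auto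
qed

text \<open>
  Since $\theta f = f p$ with $p$ tame, tameness of $f$ to some order gives it to the next order,
  and $\theta f$ tends to 0 with $f$. In this way the tameness of the primary monomials follows
  from the sole fact that they vanish at the corner.
\<close>

lemma log_tame_imp_tame:
  assumes "log_tame x0 k f \<alpha>" "(f \<longlongrightarrow> 0) (corner x0)"
  shows "tame x0 k f 0"
proof -
  obtain p where p: "tame x0 k p \<alpha>" "\<forall>\<^sub>F z in corner x0. f z \<noteq> 0 \<and> euler_deriv f z (f z * p z)"
    using assms unfolding log_tame_def by blast
  have d: "\<forall>\<^sub>F z in corner x0. euler_deriv f z (f z * p z)"
    using p(2) by eventually_elim simp
  have "j \<le> k \<Longrightarrow> tame x0 j f 0" for j
  proof (induction j)
    case (Suc j)
    then have "tame x0 j (\<lambda>z. f z * p z) (0 * \<alpha>)"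
      using p(1) by (intro tame_mult tame_antimono[OF _ p(1)]) auto
    with d assms(2) show ?case by auto
  qed (use assms(2) in auto)
  then show ?thesis by simp
qed

lemma log_tame_r: "log_tame x0 k fst 1"
proof -
  have "\<forall>\<^sub>F z in corner x0. fst z \<noteq> 0 \<and> euler_deriv fst z (fst z * 1)"
    using eventually_corner_positive by eventually_elim (auto intro: euler_deriv_r)
  then show ?thesis
    unfolding log_tame_def using tame_const[of x0 k 1] by blast
qed

lemma log_tame_rho: "log_tame x0 k (\<lambda>z. fst (snd z)) (- 1)"
proof -
  have "\<forall>\<^sub>F z in corner x0. fst (snd z) \<noteq> 0 \<and> euler_deriv (\<lambda>z. fst (snd z)) z (fst (snd z) * -1)"
    using eventually_corner_positive by eventually_elim (auto intro: euler_deriv_rho)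
  then show ?thesis
    unfolding log_tame_def using tame_const[of x0 k "-1"] by blast
qed

section \<open>Compensators\<close>

text \<open>
  This form of the definition also covers $\gamma = 0$, and it is what makes the
  $\theta$-derivatives of the compensators polynomial expressions in compensators.
\<close>

lemma powr_minus_conv_omega: "0 < r \<Longrightarrow> r powr - \<gamma> = 1 + \<gamma> * omega r \<gamma>"
  by (simp add: omega_def)

lemma DERIV_omega:
  assumes "0 < r"
  shows "((\<lambda>r. omega r \<gamma>) has_real_derivative - (r powr - \<gamma>) / r) (at r)"
proof (cases "\<gamma> = 0")
  case True
  then show ?thesis
    using assms by (auto simp: omega_def intro!: derivative_eq_intros)
next
  case False
  then show ?thesis
    using assms by (auto simp: omega_def powr_diff intro!: derivative_eq_intros)
qed

lemma omega_pos: "0 < r \<Longrightarrow> r < 1 \<Longrightarrow> 0 < omega r \<gamma>"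
  by (auto simp: omega_def powr_def zero_less_divide_iff mult_less_0_iff zero_less_mult_iff)

lemma omega_antimono:
  assumes "0 < r" "r \<le> s"
  shows "omega s \<gamma> \<le> omega r \<gamma>"
proof (rule DERIV_nonpos_imp_nonincreasing[OF assms(2)])
  show "\<exists>y. ((\<lambda>r. omega r \<gamma>) has_real_derivative y) (at x) \<and> y \<le> 0" if "r \<le> x" "x \<le> s" for x
    using that assms DERIV_omega[of x \<gamma>] by (intro exI conjI) auto
qed

lemma minus_ln_le_omega:
  assumes "0 < r" "0 \<le> \<delta>"
  shows "- ln r \<le> omega r \<delta>"
proof (cases "\<delta> = 0")
  case False
  have "1 + (- \<delta> * ln r) \<le> r powr - \<delta>"
    using assms exp_ge_add_one_self[of "- \<delta> * ln r"] by (simp add: powr_def)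
  then show ?thesis
    using assms False by (simp add: omega_def field_simps)
qed (simp add: omega_def)

text \<open>
  At $\gamma = 0$ this is the second order Taylor coefficient of
  $e^{-\gamma \ln r}$ at $\gamma = 0$.
\<close>

lemma DERIV_omega_param:
  assumes "0 < r"
  shows "(omega r has_real_derivative
     (if \<gamma> = 0 then (ln r)\<^sup>2 / 2 else (- ln r * r powr - \<gamma> - omega r \<gamma>) / \<gamma>)) (at \<gamma>)"
proof (cases "\<gamma> = 0")
  case True
  have "((\<lambda>h::real. ((exp (- h * c) - 1) / h + c) / h) \<longlongrightarrow> c * c / 2) (at 0)" for c :: real
  proof (cases "c = 0")
    case False
    then consider "c > 0" | "c < 0" by linarith
    then show ?thesis
    proof cases
      case 1
      then show ?thesis by real_asymp
    next
      case 2
      then show ?thesis by real_asymp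
    qed
  qed simp
  then have "((\<lambda>h. ((exp (- h * ln r) - 1) / h + ln r) / h) \<longlongrightarrow> ln r * ln r / 2) (at 0)" .
  moreover have "\<forall>\<^sub>F h in at 0. ((exp (- h * ln r) - 1) / h + ln r) / h = (omega r (0 + h) - omega r 0) / h"
    unfolding eventually_at by (intro exI[of _ 1]) (use assms in \<open>auto simp: omega_def powr_def\<close>)
  ultimately have "((\<lambda>h. (omega r (0 + h) - omega r 0) / h) \<longlongrightarrow> ln r * ln r / 2) (at 0)"
    by (rule Lim_transform_eventually)
  then show ?thesis
    by (simp add: DERIV_def True power2_eq_square)
next
  case False
  have "((\<lambda>\<gamma>. (r powr - \<gamma> - 1) / \<gamma>) has_real_derivative (- ln r * r powr - \<gamma> - omega r \<gamma>) / \<gamma>) (at \<gamma>)"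
    using assms False
    by (auto intro!: derivative_eq_intros simp: omega_def field_simps power2_eq_square)
  moreover have "open (- {0::real})" by auto
  ultimately show ?thesis
    using False has_field_derivative_transform_within_open[of "\<lambda>\<gamma>. (r powr - \<gamma> - 1) / \<gamma>" _ \<gamma> "- {0}" "omega r"]
    by (auto simp: omega_def)
qed

lemma Omega_diagonal:
  "0 < r \<Longrightarrow> Omega r \<gamma> \<gamma> = (if \<gamma> = 0 then (ln r)\<^sup>2 / 2 else (- ln r * r powr - \<gamma> - omega r \<gamma>) / \<gamma>)"
  using DERIV_imp_deriv[OF DERIV_omega_param[of r \<gamma>]] by (simp add: Omega_def)

text \<open>
  The expression on the left is $-\theta\Omega_{\gamma_1,\gamma_2}$. The product on the right, which
  is the divided difference of $\gamma \mapsto r^{-\gamma}$, shows its sign and its size uniformly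
  in both parameters, without a distinction of the case $\gamma_1 = \gamma_2$.
\<close>

lemma omega_add_Omega:
  assumes "0 < r"
  shows "omega r \<gamma>1 + \<gamma>2 * Omega r \<gamma>1 \<gamma>2 = r powr - \<gamma>1 * omega r (\<gamma>2 - \<gamma>1)"
proof (cases "\<gamma>1 = \<gamma>2")
  case True
  then show ?thesis
    using assms by (simp add: Omega_diagonal) (simp add: omega_def)
next
  case False
  have "r powr - \<gamma>2 = r powr - \<gamma>1 * r powr - (\<gamma>2 - \<gamma>1)"
    by (simp add: powr_add[symmetric])
  then have eq: "1 + \<gamma>2 * omega r \<gamma>2 = (1 + \<gamma>1 * omega r \<gamma>1) * (1 + (\<gamma>2 - \<gamma>1) * omega r (\<gamma>2 - \<gamma>1))"
    using assms by (simp add: powr_minus_conv_omega[symmetric])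
  have "(omega r \<gamma>1 + \<gamma>2 * Omega r \<gamma>1 \<gamma>2) * (\<gamma>2 - \<gamma>1) =
      \<gamma>2 * omega r \<gamma>2 - \<gamma>1 * omega r \<gamma>1"
    using False by (simp add: Omega_def field_simps)
  also have "\<dots> = (r powr - \<gamma>1 * omega r (\<gamma>2 - \<gamma>1)) * (\<gamma>2 - \<gamma>1)"
    using eq assms powr_minus_conv_omega[OF assms, of \<gamma>1] by (simp add: algebra_simps)
  finally show ?thesis
    using False by simp
qed

lemma DERIV_Omega:
  assumes "0 < r"
  shows "((\<lambda>r. Omega r \<gamma>1 \<gamma>2) has_real_derivative - (omega r \<gamma>1 + \<gamma>2 * Omega r \<gamma>1 \<gamma>2) / r) (at r)"
proof (cases "\<gamma>1 = \<gamma>2")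
  case True
  have "((\<lambda>r. if \<gamma>2 = 0 then (ln r)\<^sup>2 / 2 else (- ln r * r powr - \<gamma>2 - omega r \<gamma>2) / \<gamma>2)
      has_real_derivative r powr - \<gamma>2 * ln r / r) (at r)"
  proof (cases "\<gamma>2 = 0")
    case False
    have "((\<lambda>r. (- ln r * r powr - \<gamma>2 - omega r \<gamma>2) / \<gamma>2)
      has_real_derivative r powr - \<gamma>2 * ln r / r) (at r)"
      using False assms
      by (auto intro!: derivative_eq_intros DERIV_omega simp: powr_diff field_simps)
    with False show ?thesis by simp
  qed (use assms in \<open>auto intro!: derivative_eq_intros\<close>)
  then have "((\<lambda>r. Omega r \<gamma>1 \<gamma>2) has_real_derivative r powr - \<gamma>2 * ln r / r) (at r)"
    using assms True
    by (elim has_field_derivative_transform_within_open[where S = "{0<..}"]) (auto simp: Omega_diagonal)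
  then show ?thesis
    unfolding omega_add_Omega[OF assms] True by (simp add: omega_def)
next
  case False
  have "- (omega r \<gamma>1 + \<gamma>2 * Omega r \<gamma>1 \<gamma>2) / r = (- (r powr - \<gamma>1) / r - - (r powr - \<gamma>2) / r) / (\<gamma>1 - \<gamma>2)"
    using False assms by (simp add: Omega_def powr_minus_conv_omega field_simps)
  then show ?thesis
    using False assms DERIV_cdivide[OF DERIV_diff[OF DERIV_omega DERIV_omega], of r \<gamma>1 \<gamma>2 "\<gamma>1 - \<gamma>2"]
    by (simp add: Omega_def)
qed

lemma Omega_commute: "Omega r \<gamma>1 \<gamma>2 = Omega r \<gamma>2 \<gamma>1"
  by (simp add: Omega_def field_simps)

text \<open>
  $\Omega$ vanishes at $r = 1$, and by the formula above it decreases in $r$.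
\<close>

lemma Omega_pos:
  assumes "0 < r" "r < 1"
  shows "0 < Omega r \<gamma>1 \<gamma>2"
proof -
  have *: "\<exists>y. ((\<lambda>r. Omega r \<gamma>1 \<gamma>2) has_real_derivative y) (at x) \<and> y < 0" if "r < x" "x < 1" for x
    using that assms DERIV_Omega[of x \<gamma>1 \<gamma>2] omega_pos[of x "\<gamma>2 - \<gamma>1"]
    by (intro exI conjI) (auto simp: omega_add_Omega intro!: divide_neg_pos)
  have "Omega 1 \<gamma>1 \<gamma>2 < Omega r \<gamma>1 \<gamma>2"
  proof (rule DERIV_neg_imp_decreasing_open[OF assms(2) *])
    show "continuous_on {r..1} (\<lambda>r. Omega r \<gamma>1 \<gamma>2)"
      using assms by (intro continuous_at_imp_continuous_on ballI DERIV_isCont[OF DERIV_Omega]) auto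
  qed
  moreover have "omega 1 = (\<lambda>_. 0)"
    by (auto simp: omega_def)
  then have "Omega 1 \<gamma>1 \<gamma>2 = 0"
    by (simp add: Omega_def)
  ultimately show ?thesis by simp
qed

text \<open>
  The difference of both sides is nonnegative at $r = s$ and decreases in $r$, since
  $-\theta\Omega \ge r^{-\gamma_1}(-\ln r)$ by the formula above, while
  $-\theta\omega_{\gamma_1} = r^{-\gamma_1}$. With $s$ close to 0 the factor $-\ln s$ becomes
  arbitrarily large; hence $\Omega$ dominates $\omega_{\gamma_1}$.
\<close>

lemma Omega_ge_multiple_omega:
  assumes "0 < r" "r \<le> s" "s < 1" "\<gamma>1 \<le> \<gamma>2"
  shows "- ln s * (omega r \<gamma>1 - omega s \<gamma>1) \<le> Omega r \<gamma>1 \<gamma>2"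
proof -
  let ?D = "\<lambda>t. Omega t \<gamma>1 \<gamma>2 - (- ln s) * omega t \<gamma>1"
  have "?D s \<le> ?D r"
  proof (rule DERIV_nonpos_imp_nonincreasing[OF assms(2)])
    fix t assume t: "r \<le> t" "t \<le> s"
    then have pos: "0 < t" using assms by simp
    have "(?D has_real_derivative
        - (omega t \<gamma>1 + \<gamma>2 * Omega t \<gamma>1 \<gamma>2) / t - (- ln s) * (- (t powr - \<gamma>1) / t)) (at t)"
      by (intro DERIV_diff DERIV_cmult DERIV_Omega DERIV_omega pos)
    moreover have "- (omega t \<gamma>1 + \<gamma>2 * Omega t \<gamma>1 \<gamma>2) / t - (- ln s) * (- (t powr - \<gamma>1) / t)
        = t powr - \<gamma>1 / t * (- ln s - omega t (\<gamma>2 - \<gamma>1))"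
      unfolding omega_add_Omega[OF pos] using pos by (simp add: field_simps)
    moreover have "- ln s \<le> - ln t"
      using pos t by simp
    then have "- ln s - omega t (\<gamma>2 - \<gamma>1) \<le> 0"
      using minus_ln_le_omega[OF pos, of "\<gamma>2 - \<gamma>1"] assms by linarith
    then have "t powr - \<gamma>1 / t * (- ln s - omega t (\<gamma>2 - \<gamma>1)) \<le> 0"
      using pos by (intro mult_nonneg_nonpos) auto
    ultimately show "\<exists>y. (?D has_real_derivative y) (at t) \<and> y \<le> 0"
      by auto
  qed
  moreover have "0 < Omega s \<gamma>1 \<gamma>2"
    using assms by (intro Omega_pos) auto
  ultimately show ?thesis
    by (simp add: algebra_simps)
qed

text \<open>
  As $\omega$ decreases in $r$, it suffices that its value at a fixed small $s$ is large. For
  $\gamma = 0$ this value is $-\ln s$, and it depends continuously on $\gamma$.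
\<close>

lemma filterlim_omega_corner:
  assumes "(\<gamma> \<longlongrightarrow> 0) (nhds x0)"
  shows "filterlim (\<lambda>z. omega (fst z) (\<gamma> (snd (snd z)))) at_top (corner x0)"
  unfolding filterlim_at_top
proof
  fix Z :: real
  define s where "s = exp (- (\<bar>Z\<bar> + 1))"
  have "isCont (omega s) 0"
    by (rule DERIV_isCont[OF DERIV_omega_param]) (simp add: s_def)
  then have "((\<lambda>z. omega s (\<gamma> (snd (snd z)))) \<longlongrightarrow> omega s 0) (corner x0)"
    by (intro isCont_tendsto_compose[where g = "omega s"] filterlim_compose[OF assms tendsto_param_corner])
  moreover have "omega s 0 > Z"
    by (simp add: omega_def s_def)
  ultimately have "\<forall>\<^sub>F z in corner x0. omega s (\<gamma> (snd (snd z))) > Z"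
    by (rule order_tendstoD)
  moreover have "\<forall>\<^sub>F z in corner x0. fst z < s"
    unfolding eventually_corner by (intro exI[of _ s]) (simp add: s_def)
  ultimately show "\<forall>\<^sub>F z in corner x0. Z \<le> omega (fst z) (\<gamma> (snd (snd z)))"
    using eventually_corner_positive
    by eventually_elim (use omega_antimono[of _ s] in \<open>smt (verit)\<close>)
qed

lemma tendsto_inverse_omega:
  "(\<gamma> \<longlongrightarrow> 0) (nhds x0) \<Longrightarrow> ((\<lambda>z. inverse (omega (fst z) (\<gamma> (snd (snd z))))) \<longlongrightarrow> 0) (corner x0)"
  by (intro tendsto_inverse_0_at_top filterlim_omega_corner)

text \<open>
  For the smaller of the two parameters this follows from the domination of $\omega$ by $\Omega$.
  The other compensator differs from it by $(\gamma_1 - \gamma_2)\Omega$, which is small compared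
  with $\Omega$.
\<close>

lemma tendsto_omega_over_Omega:
  assumes "(\<gamma>1 \<longlongrightarrow> 0) (nhds x0)" "(\<gamma>2 \<longlongrightarrow> 0) (nhds x0)"
  shows "((\<lambda>z. omega (fst z) (\<gamma>1 (snd (snd z))) *
      inverse (Omega (fst z) (\<gamma>1 (snd (snd z))) (\<gamma>2 (snd (snd z))))) \<longlongrightarrow> 0) (corner x0)"
proof (rule tendstoI)
  fix e :: real assume e: "e > 0"
  \<comment> \<open>With $-\ln s = N = 4/e$ the domination by $\Omega$ makes the quotient for the smaller parameter at most $2/N = e/2$.\<close>
  define N where "N = 4 / e"
  define s where "s = exp (- N)"
  define m where "m = (\<lambda>x. min (\<gamma>1 x) (\<gamma>2 x))"
  have N: "N > 0" and s: "0 < s" "s < 1" and ln_s: "- ln s = N"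
    using e by (auto simp: N_def s_def)
  have m: "(m \<longlongrightarrow> 0) (nhds x0)"
    unfolding m_def using tendsto_min[OF assms] by simp
  have "isCont (omega s) 0"
    by (rule DERIV_isCont[OF DERIV_omega_param[OF s(1)]])
  then have "((\<lambda>z. omega s (m (snd (snd z)))) \<longlongrightarrow> omega s 0) (corner x0)"
    by (intro isCont_tendsto_compose[where g = "omega s"] filterlim_compose[OF m tendsto_param_corner])
  moreover have "omega s 0 < N + 1"
    by (simp add: omega_def ln_s)
  ultimately have ev1: "\<forall>\<^sub>F z in corner x0. omega s (m (snd (snd z))) < N + 1"
    by (rule order_tendstoD)
  have ev2: "\<forall>\<^sub>F z in corner x0. fst z < s"
    unfolding eventually_corner using s by (intro exI[of _ s]) simp
  have ev3: "\<forall>\<^sub>F z in corner x0. 2 * (N + 1) \<le> omega (fst z) (m (snd (snd z)))"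
    using filterlim_omega_corner[OF m] unfolding filterlim_at_top by blast
  have "((\<lambda>z. \<bar>\<gamma>1 (snd (snd z)) - \<gamma>2 (snd (snd z))\<bar>) \<longlongrightarrow> \<bar>0 - 0\<bar>) (corner x0)"
    by (intro tendsto_intros filterlim_compose[OF _ tendsto_param_corner] assms)
  then have ev4: "\<forall>\<^sub>F z in corner x0. \<bar>\<gamma>1 (snd (snd z)) - \<gamma>2 (snd (snd z))\<bar> < e / 2"
    using e by (intro order_tendstoD) auto
  show "\<forall>\<^sub>F z in corner x0. dist (omega (fst z) (\<gamma>1 (snd (snd z))) *
      inverse (Omega (fst z) (\<gamma>1 (snd (snd z))) (\<gamma>2 (snd (snd z))))) 0 < e"
    using ev1 ev2 ev3 ev4 eventually_corner_positive
  proof eventually_elim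
    case (elim z)
    define r g1 g2 where "r = fst z" and "g1 = \<gamma>1 (snd (snd z))" and "g2 = \<gamma>2 (snd (snd z))"
    define g where "g = min g1 g2"
    have r: "0 < r" "r < 1" "r \<le> s" and bounds: "omega s g < N + 1" "2 * (N + 1) \<le> omega r g" "\<bar>g1 - g2\<bar> < e / 2"
      using elim by (auto simp: r_def g1_def g2_def g_def m_def)
    have Om: "0 < Omega r g1 g2" using r by (intro Omega_pos)
    have "N * (omega r g - omega s g) \<le> Omega r g (max g1 g2)"
      unfolding ln_s[symmetric] by (rule Omega_ge_multiple_omega[OF r(1,3) s(2)]) (simp add: g_def)
    also have "\<dots> = Omega r g1 g2"
      by (auto simp: g_def min_def max_def Omega_commute)
    finally have "N * (omega r g - omega s g) \<le> Omega r g1 g2" .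
    \<comment> \<open>Near the corner $\omega_g(r)$ is at least twice $\omega_g(s)$, which costs a factor 2.\<close>
    moreover have "N * (omega r g / 2) \<le> N * (omega r g - omega s g)"
      using N bounds by (intro mult_left_mono) auto
    ultimately have "N * omega r g \<le> 2 * Omega r g1 g2" by linarith
    then have "omega r g \<le> e / 2 * Omega r g1 g2"
      using e by (simp add: N_def field_simps)
    moreover have "omega r g1 \<le> omega r g + \<bar>g1 - g2\<bar> * Omega r g1 g2"
    proof (cases "g1 \<le> g2")
      case False
      then have "omega r g1 = omega r g2 + (g1 - g2) * Omega r g1 g2"
        by (simp add: Omega_def)
      with False show ?thesis by (simp add: g_def)
    qed (use Om in \<open>simp add: g_def\<close>)
    moreover have "\<bar>g1 - g2\<bar> * Omega r g1 g2 < e / 2 * Omega r g1 g2"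
      using bounds Om by (intro mult_strict_right_mono) auto
    ultimately have "omega r g1 < e * Omega r g1 g2" by (simp add: field_simps)
    moreover have "0 < omega r g1" using r by (intro omega_pos)
    ultimately show ?case
      using Om by (simp add: r_def g1_def g2_def field_simps)
  qed
qed

lemma tendsto_inverse_Omega:
  assumes "(\<gamma>1 \<longlongrightarrow> 0) (nhds x0)" "(\<gamma>2 \<longlongrightarrow> 0) (nhds x0)"
  shows "((\<lambda>z. inverse (Omega (fst z) (\<gamma>1 (snd (snd z))) (\<gamma>2 (snd (snd z))))) \<longlongrightarrow> 0) (corner x0)"
proof (rule Lim_transform_eventually)
  show "((\<lambda>z. omega (fst z) (\<gamma>1 (snd (snd z))) * inverse (Omega (fst z) (\<gamma>1 (snd (snd z))) (\<gamma>2 (snd (snd z))))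
     * inverse (omega (fst z) (\<gamma>1 (snd (snd z))))) \<longlongrightarrow> 0) (corner x0)"
    using tendsto_mult[OF tendsto_omega_over_Omega[OF assms] tendsto_inverse_omega[OF assms(1)]] by simp
  show "\<forall>\<^sub>F z in corner x0. omega (fst z) (\<gamma>1 (snd (snd z))) *
      inverse (Omega (fst z) (\<gamma>1 (snd (snd z))) (\<gamma>2 (snd (snd z)))) * inverse (omega (fst z) (\<gamma>1 (snd (snd z))))
      = inverse (Omega (fst z) (\<gamma>1 (snd (snd z))) (\<gamma>2 (snd (snd z))))"
    using eventually_corner_positive
  proof eventually_elim
    case (elim z)
    then show ?case
      using omega_pos[of "fst z" "\<gamma>1 (snd (snd z))"] by simp
  qed
qed

lemma euler_deriv_omega:
  assumes "0 < fst z"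
  shows "euler_deriv (\<lambda>z. omega (fst z) (\<gamma> (snd (snd z)))) z
     (- (1 + \<gamma> (snd (snd z)) * omega (fst z) (\<gamma> (snd (snd z)))))"
  using euler_deriv_radial[of "\<lambda>r x. omega r (\<gamma> x)"] DERIV_omega[OF assms] assms
  by (simp add: powr_minus_conv_omega)

lemma euler_deriv_Omega:
  assumes "0 < fst z"
  shows "euler_deriv (\<lambda>z. Omega (fst z) (\<gamma>1 (snd (snd z))) (\<gamma>2 (snd (snd z)))) z
     (- (omega (fst z) (\<gamma>1 (snd (snd z))) +
         \<gamma>2 (snd (snd z)) * Omega (fst z) (\<gamma>1 (snd (snd z))) (\<gamma>2 (snd (snd z)))))"
  using euler_deriv_radial[of "\<lambda>r x. Omega r (\<gamma>1 x) (\<gamma>2 x)"] DERIV_Omega[OF assms] by simp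

text \<open>
  The function $y = 1/\omega$ satisfies $\theta y = y^2 + \gamma y$. So every further derivative
  is controlled by $y$ and $\gamma$.
\<close>

lemma tame_inverse_omega:
  assumes "(\<gamma> \<longlongrightarrow> 0) (nhds x0)"
  shows "tame x0 k (\<lambda>z. inverse (omega (fst z) (\<gamma> (snd (snd z))))) 0"
proof (induction k)
  case (Suc k)
  let ?y = "\<lambda>z. inverse (omega (fst z) (\<gamma> (snd (snd z))))"
  have "\<forall>\<^sub>F z in corner x0. euler_deriv ?y z (?y z * ?y z + \<gamma> (snd (snd z)) * ?y z)"
    using eventually_corner_positive
  proof eventually_elim
    case (elim z)
    then have "omega (fst z) (\<gamma> (snd (snd z))) \<noteq> 0"
      using omega_pos[of "fst z" "\<gamma> (snd (snd z))"] by simp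
    then show ?case
      using elim euler_deriv_inverse[OF _ euler_deriv_omega, of z \<gamma>] by (simp add: field_simps)
  qed
  moreover have "tame x0 k (\<lambda>z. ?y z * ?y z + \<gamma> (snd (snd z)) * ?y z) (0 * 0 + 0 * 0)"
    by (intro tame_add tame_mult tame_param Suc assms)
  ultimately show ?case
    using tendsto_inverse_omega[OF assms] by auto
qed (use tendsto_inverse_omega[OF assms] in auto)

text \<open>
  For $q = \omega_{\gamma_1}/\Omega$ and $w = 1/\Omega$ the field $\theta$ acts by
  $\theta q = q^2 + (\gamma_2 - \gamma_1) q - w$ and $\theta w = q w + \gamma_2 w$. The two functions
  occur in the derivatives of each other, so their tameness is proved by a joint induction.
\<close>

lemma tame_inverse_Omega:
  assumes "(\<gamma>1 \<longlongrightarrow> 0) (nhds x0)" "(\<gamma>2 \<longlongrightarrow> 0) (nhds x0)"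
  defines "Om \<equiv> \<lambda>z. Omega (fst z) (\<gamma>1 (snd (snd z))) (\<gamma>2 (snd (snd z)))"
  defines "om \<equiv> \<lambda>z. omega (fst z) (\<gamma>1 (snd (snd z)))"
  shows "tame x0 k (\<lambda>z. om z * inverse (Om z)) 0 \<and> tame x0 k (\<lambda>z. inverse (Om z)) 0"
proof (induction k)
  case 0
  then show ?case
    using tendsto_omega_over_Omega[OF assms(1,2)] tendsto_inverse_Omega[OF assms(1,2)]
    by (simp add: om_def Om_def)
next
  case (Suc k)
  let ?q = "\<lambda>z. om z * inverse (Om z)" and ?w = "\<lambda>z. inverse (Om z)"
    and ?g1 = "\<lambda>z. \<gamma>1 (snd (snd z))" and ?g2 = "\<lambda>z. \<gamma>2 (snd (snd z))"
  have inv: "\<forall>\<^sub>F z in corner x0. Om z \<noteq> 0 \<and> euler_deriv ?w z (?q z * ?w z + ?g2 z * ?w z)"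
    using eventually_corner_positive
  proof eventually_elim
    case (elim z)
    then have nz: "Om z \<noteq> 0"
      using Omega_pos[of "fst z" "?g1 z" "?g2 z"] by (simp add: Om_def)
    have "euler_deriv Om z (- (om z + ?g2 z * Om z))"
      using elim unfolding Om_def om_def by (intro euler_deriv_Omega) auto
    from euler_deriv_inverse[OF _ this] show ?case
      using elim nz by (simp add: field_simps)
  qed
  then have ev1: "\<forall>\<^sub>F z in corner x0. euler_deriv ?w z (?q z * ?w z + ?g2 z * ?w z)"
    by eventually_elim simp
  have ev2: "\<forall>\<^sub>F z in corner x0. euler_deriv ?q z (?q z * ?q z + (?g2 z - ?g1 z) * ?q z - ?w z)"
    using inv eventually_corner_positive
  proof eventually_elim
    case (elim z)
    have "euler_deriv om z (- (1 + ?g1 z * om z))"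
      using elim unfolding om_def by (intro euler_deriv_omega) auto
    from euler_deriv_mult[OF _ this conjunct2[OF elim(1)]] show ?case
      using elim by (simp add: algebra_simps)
  qed
  have "tame x0 k (\<lambda>z. ?q z * ?w z + ?g2 z * ?w z) (0 * 0 + 0 * 0)"
       "tame x0 k (\<lambda>z. ?q z * ?q z + (?g2 z - ?g1 z) * ?q z - ?w z) (0 * 0 + (0 - 0) * 0 - 0)"
    by (intro tame_add tame_mult tame_diff tame_param assms(1,2) conjunct1[OF Suc] conjunct2[OF Suc])+
  with ev1 ev2 show ?case
    using tendsto_omega_over_Omega[OF assms(1,2)] tendsto_inverse_Omega[OF assms(1,2)]
    by (auto simp: om_def Om_def)
qed

lemma log_tame_omega:
  assumes "(\<gamma> \<longlongrightarrow> 0) (nhds x0)"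
  shows "log_tame x0 k (\<lambda>z. omega (fst z) (\<gamma> (snd (snd z)))) 0"
proof -
  let ?om = "\<lambda>z. omega (fst z) (\<gamma> (snd (snd z)))"
  let ?p = "\<lambda>z. - (inverse (?om z) + \<gamma> (snd (snd z)))"
  have "tame x0 k ?p (- (0 + 0))"
    by (intro tame_uminus tame_add tame_inverse_omega tame_param assms)
  moreover have "\<forall>\<^sub>F z in corner x0. ?om z \<noteq> 0 \<and> euler_deriv ?om z (?om z * ?p z)"
    using eventually_corner_positive
  proof eventually_elim
    case (elim z)
    then have "?om z \<noteq> 0" and "- (1 + \<gamma> (snd (snd z)) * ?om z) = ?om z * ?p z"
      using omega_pos[of "fst z" "\<gamma> (snd (snd z))"] by (simp_all add: field_simps)
    then show ?case
      using elim euler_deriv_omega[of z \<gamma>] by simp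
  qed
  ultimately show ?thesis
    unfolding log_tame_def by auto
qed

lemma log_tame_Omega:
  assumes "(\<gamma>1 \<longlongrightarrow> 0) (nhds x0)" "(\<gamma>2 \<longlongrightarrow> 0) (nhds x0)"
  shows "log_tame x0 k (\<lambda>z. Omega (fst z) (\<gamma>1 (snd (snd z))) (\<gamma>2 (snd (snd z)))) 0"
proof -
  let ?Om = "\<lambda>z. Omega (fst z) (\<gamma>1 (snd (snd z))) (\<gamma>2 (snd (snd z)))"
  let ?p = "\<lambda>z. - (omega (fst z) (\<gamma>1 (snd (snd z))) * inverse (?Om z) + \<gamma>2 (snd (snd z)))"
  have "tame x0 k ?p (- (0 + 0))"
    by (intro tame_uminus tame_add conjunct1[OF tame_inverse_Omega] tame_param assms)
  moreover have "\<forall>\<^sub>F z in corner x0. ?Om z \<noteq> 0 \<and> euler_deriv ?Om z (?Om z * ?p z)"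
    using eventually_corner_positive
  proof eventually_elim
    case (elim z)
    then have "?Om z \<noteq> 0"
      and "- (omega (fst z) (\<gamma>1 (snd (snd z))) + \<gamma>2 (snd (snd z)) * ?Om z) = ?Om z * ?p z"
      using Omega_pos[of "fst z" "\<gamma>1 (snd (snd z))" "\<gamma>2 (snd (snd z))"] by (simp_all add: field_simps)
    then show ?case
      using elim euler_deriv_Omega[of z \<gamma>1 \<gamma>2] by simp
  qed
  ultimately show ?thesis
    unfolding log_tame_def by auto
qed

section \<open>Functions on monomials\<close>

lemma smooth_on_imp_tendsto:
  assumes "smooth_on B c" "x0 \<in> B"
  shows "(c \<longlongrightarrow> c x0) (nhds x0)"
proof -
  obtain W where W: "open W" "B \<subseteq> W" "\<forall>k. Ck_on k W c"
    using assms(1) unfolding smooth_on_def by blast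
  have "continuous_on W c" using W(3)[rule_format, of 0] by simp
  then have "isCont c x0"
    using W assms(2) by (auto simp: continuous_on_eq_continuous_at)
  then show ?thesis
    by (simp add: isCont_def tendsto_nhds_iff)
qed

lemma log_tame_primary_expression:
  assumes "primary_expression B x0 e" "x0 \<in> B"
  shows "\<exists>\<alpha>. \<forall>k. log_tame x0 k (\<lambda>z. e (fst z) (fst (snd z)) (snd (snd z))) \<alpha>"
proof -
  have pos: "\<forall>\<^sub>F z in corner x0. 0 < fst z" "\<forall>\<^sub>F z in corner x0. 0 < fst (snd z)"
     "\<And>\<gamma>. \<forall>\<^sub>F z in corner x0. 0 < omega (fst z) (\<gamma> (snd (snd z)))"
     "\<And>\<gamma>1 \<gamma>2. \<forall>\<^sub>F z in corner x0. 0 < Omega (fst z) (\<gamma>1 (snd (snd z))) (\<gamma>2 (snd (snd z)))"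
    using eventually_corner_positive by (eventually_elim; simp add: omega_pos Omega_pos)+
  note lim = smooth_on_imp_tendsto[OF _ assms(2)]
  have lim0: "(\<gamma> \<longlongrightarrow> 0) (nhds x0)" if "smooth_on B \<gamma>" "\<gamma> x0 = 0" for \<gamma>
    using lim[OF that(1)] that(2) by simp
  show ?thesis
    using assms(1)
  proof cases
    case (1 a)
    show ?thesis unfolding 1(1) by (intro exI[of _ "a x0 * 1"] allI log_tame_powr log_tame_r pos lim 1)
  next
    case (2 b)
    show ?thesis unfolding 2(1) by (intro exI[of _ "b x0 * - 1"] allI log_tame_powr log_tame_rho pos lim 2)
  next
    case (3 a c \<gamma>)
    show ?thesis unfolding 3(1)
      by (intro exI[of _ "a x0 * 1 + c x0 * 0"] allI log_tame_mult log_tame_powr log_tame_r log_tame_omega pos lim lim0 3)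
  next
    case (4 a d \<gamma>1 \<gamma>2)
    show ?thesis unfolding 4(1)
      by (intro exI[of _ "a x0 * 1 + d x0 * 0"] allI log_tame_mult log_tame_powr log_tame_r log_tame_Omega pos lim lim0 4)
  next
    case (5 e' \<gamma>)
    show ?thesis unfolding 5(1)
      by (intro exI[of _ "- e' x0 * 0"] allI log_tame_powr log_tame_omega[OF lim0] pos tendsto_minus lim 5)
  qed
qed

text \<open>
  The limit 0 comes from the continuous extension to $r = 0$; the derivatives are those of the
  explicit expression, which is \<open>log_tame\<close>.
\<close>

lemma tame_primary_monomial:
  assumes "primary_monomial r1 \<rho>1 B x0 m" "0 < r1" "0 < \<rho>1" "x0 \<in> interior B"
  shows "tame x0 k (\<lambda>z. m (fst z) (fst (snd z)) (snd (snd z))) 0"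
proof -
  let ?m = "\<lambda>z. m (fst z) (fst (snd z)) (snd (snd z))"
  obtain e where e: "primary_expression B x0 e"
      "\<And>r \<rho> x. 0 < r \<Longrightarrow> r \<le> r1 \<Longrightarrow> 0 \<le> \<rho> \<Longrightarrow> \<rho> \<le> \<rho>1 \<Longrightarrow> x \<in> B \<Longrightarrow> m r \<rho> x = e r \<rho> x"
    and cont: "continuous_on ({0..r1} \<times> {0..\<rho>1} \<times> B) (\<lambda>(r, \<rho>, x). m r \<rho> x)" and zero: "m 0 0 x0 = 0"
    using assms(1) unfolding primary_monomial_def by force
  obtain d where d: "d > 0" "ball x0 d \<subseteq> B"
    using assms(4) by (meson mem_interior)
  have x0: "x0 \<in> B" using d by auto
  have dom: "\<forall>\<^sub>F z in corner x0. 0 < fst z \<and> fst z \<le> r1 \<and> 0 \<le> fst (snd z) \<and> fst (snd z) \<le> \<rho>1 \<and> snd (snd z) \<in> B"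
    unfolding eventually_corner
    by (rule exI[of _ "min d (min r1 \<rho>1)"]) (use d assms in \<open>auto simp: subset_iff dist_commute\<close>)
  have "filterlim (\<lambda>z. z) (at (0, 0, x0) within {0..r1} \<times> {0..\<rho>1} \<times> B) (corner x0)"
    unfolding filterlim_at
  proof
    show "\<forall>\<^sub>F z in corner x0. z \<in> {0..r1} \<times> {0..\<rho>1} \<times> B \<and> z \<noteq> (0, 0, x0)"
      using dom by eventually_elim auto
    show "((\<lambda>z. z) \<longlongrightarrow> (0, 0, x0)) (corner x0)"
      using corner_le_nhds[of x0] by (simp add: filterlim_def)
  qed
  moreover have "((\<lambda>(r, \<rho>, x). m r \<rho> x) \<longlongrightarrow> 0) (at (0, 0, x0) within {0..r1} \<times> {0..\<rho>1} \<times> B)"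
    using cont assms(2,3) x0 zero unfolding continuous_on_def by force
  ultimately have "((\<lambda>z. (\<lambda>(r, \<rho>, x). m r \<rho> x) z) \<longlongrightarrow> 0) (corner x0)"
    by (rule filterlim_compose[rotated])
  then have lim: "(?m \<longlongrightarrow> 0) (corner x0)"
    by (simp add: case_prod_beta)
  obtain \<alpha> where \<alpha>: "\<And>k. log_tame x0 k (\<lambda>z. e (fst z) (fst (snd z)) (snd (snd z))) \<alpha>"
    using log_tame_primary_expression[OF e(1) x0] by blast
  have eq: "\<forall>\<^sub>F z in corner x0. e (fst z) (fst (snd z)) (snd (snd z)) = ?m z"
    using dom by eventually_elim (use e(2) in auto)
  have "((\<lambda>z. e (fst z) (fst (snd z)) (snd (snd z))) \<longlongrightarrow> 0) (corner x0)"
    using eq by (intro Lim_transform_eventually[OF lim]) (auto elim: eventually_mono)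
  from tame_cong[OF eq log_tame_imp_tame[OF \<alpha> this]] show ?thesis .
qed

lemma tendsto_fun_componentwise:
  fixes f :: "'a \<Rightarrow> 'i \<Rightarrow> real"
  assumes "\<And>i. ((\<lambda>a. f a i) \<longlongrightarrow> l i) F"
  shows "(f \<longlongrightarrow> l) F"
  using assms limitin_componentwise[of "\<lambda>_. euclideanreal" UNIV f l F]
  by (simp add: euclidean_product_topology)

text \<open>
  The topology of $\mathbf R^s$ is induced from the product topology on sequences, so a family
  within $\mathbf R^s$ that converges coordinatewise gets into relatively open sets.
\<close>

lemma openin_Euclidean_space_imp_eventually:
  assumes "openin (Euclidean_space s) U" "\<xi> \<in> U" "(f \<longlongrightarrow> \<xi>) F"
    and "\<And>a i. s \<le> i \<Longrightarrow> f a i = 0"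
  shows "\<forall>\<^sub>F a in F. f a \<in> U"
proof -
  obtain T where T: "open T" "U = T \<inter> {x. \<forall>i\<ge>s. x i = 0}"
    using assms(1) by (auto simp: Euclidean_space_def openin_subtopology euclidean_product_topology)
  have "\<forall>\<^sub>F a in F. f a \<in> T"
    using assms(2,3) T by (auto intro: topological_tendstoD)
  then show ?thesis
    by eventually_elim (use assms(4) T in auto)
qed

lemma has_real_derivative_iff_has_derivative:
  "(f has_real_derivative D) F \<longleftrightarrow> (f has_derivative (\<lambda>h. h * D)) F"
proof -
  have "(\<lambda>h. h * D) = (*) D" by (auto simp: mult.commute)
  then show ?thesis by (simp add: has_field_derivative_def)
qed

text \<open>
  The chain rule for a function whose partial derivatives are only known to exist and to be
  continuous. The coordinates are released one after the other: $\eta_n$ moves the first $n$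
  coordinates along the curve and keeps the others fixed, and the step from $n$ to $n+1$ is the
  chain rule for a function of two variables.
\<close>

lemma DERIV_compose_partials:
  fixes f :: "(nat \<Rightarrow> real) \<Rightarrow> real" and \<mu> :: "nat \<Rightarrow> real \<Rightarrow> real" and t0 :: real and s :: nat
  defines "\<xi> \<equiv> \<lambda>t i. if i < s then \<mu> i t else 0"
  assumes U: "openin (Euclidean_space s) U" "\<xi> t0 \<in> U"
    and partial: "\<And>i \<eta>. i < s \<Longrightarrow> \<eta> \<in> U \<Longrightarrow> ((\<lambda>y. f (\<eta>(i := y))) has_real_derivative D i \<eta>) (at (\<eta> i))"
    and cont: "\<And>i. i < s \<Longrightarrow> continuous_on U (D i)"
    and \<mu>: "\<And>i. i < s \<Longrightarrow> (\<mu> i has_real_derivative \<mu>' i) (at t0)"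
  shows "((\<lambda>t. f (\<xi> t)) has_real_derivative (\<Sum>i<s. D i (\<xi> t0) * \<mu>' i)) (at t0)"
proof -
  define \<eta> where "\<eta> n t = (\<lambda>i. if i < n then \<mu> i t else \<xi> t0 i)" for n t
  have "n \<le> s \<Longrightarrow> ((\<lambda>t. f (\<eta> n t)) has_real_derivative (\<Sum>i<n. D i (\<xi> t0) * \<mu>' i)) (at t0)" for n
  proof (induction n)
    case 0
    then show ?case by (simp add: \<eta>_def)
  next
    case (Suc n)
    define \<Psi> where "\<Psi> p = (\<eta> n (fst p))(n := snd p)" for p
    define y0 where "y0 = \<mu> n t0"
    have self: "\<Psi> (t, y0) = \<eta> n t" for t
      using Suc.prems by (auto simp: \<Psi>_def \<eta>_def \<xi>_def y0_def)
    have self0: "\<eta> n t0 = \<xi> t0"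
      using Suc.prems by (auto simp: \<eta>_def \<xi>_def)
    have \<mu>_lim: "((\<lambda>p. \<mu> i (fst p)) \<longlongrightarrow> \<mu> i t0) (nhds (t0, y0))" if "i < s" for i
    proof -
      have "isCont (\<mu> i) t0" using \<mu>[OF that] by (rule DERIV_isCont)
      moreover have "((\<lambda>p. fst p) \<longlongrightarrow> t0) (nhds (t0, y0))"
        using tendsto_fst[OF filterlim_ident, of "(t0, y0)"] by simp
      ultimately show ?thesis by (rule isCont_tendsto_compose)
    qed
    have "((\<lambda>p. \<Psi> p i) \<longlongrightarrow> \<xi> t0 i) (nhds (t0, y0))" for i
    proof -
      consider "i = n" | "i < n" | "n < i" by linarith
      then show ?thesis
      proof cases
        case 1
        then show ?thesis
          using tendsto_snd[OF filterlim_ident, of "(t0, y0)"] Suc.prems by (simp add: \<Psi>_def \<xi>_def y0_def)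
      next
        case 2
        then show ?thesis
          using \<mu>_lim[of i] Suc.prems by (simp add: \<Psi>_def \<xi>_def \<eta>_def)
      qed (simp add: \<Psi>_def \<eta>_def)
    qed
    then have \<Psi>_lim: "(\<Psi> \<longlongrightarrow> \<xi> t0) (nhds (t0, y0))"
      by (rule tendsto_fun_componentwise)
    have "\<forall>\<^sub>F p in nhds (t0, y0). \<Psi> p \<in> U"
      using Suc.prems by (intro openin_Euclidean_space_imp_eventually[OF U \<Psi>_lim]) (auto simp: \<Psi>_def \<eta>_def \<xi>_def)
    then obtain N where N: "open N" "(t0, y0) \<in> N" "\<forall>p\<in>N. \<Psi> p \<in> U"
      unfolding eventually_nhds by blast
    obtain X Y where XY: "open X" "open Y" "(t0, y0) \<in> X \<times> Y" "X \<times> Y \<subseteq> N"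
      using open_prod_elim[OF N(1,2)] by metis
    have in_U: "\<Psi> (t, y) \<in> U" if "t \<in> X" "y \<in> Y" for t y
      using XY(4) N(3) that by auto
    have "y0 \<in> Y" "t0 \<in> X" using XY(3) by auto
    obtain e where e: "e > 0" "ball y0 e \<subseteq> Y"
      by (rule openE[OF XY(2) \<open>y0 \<in> Y\<close>])
    have "((\<lambda>(t, y). f (\<Psi> (t, y))) has_derivative (\<lambda>(ht, hy). ht * (\<Sum>i<n. D i (\<xi> t0) * \<mu>' i) +
        blinfun_apply (blinfun_scaleR_left (D n (\<Psi> (t0, y0)))) hy)) (at (t0, y0) within X \<times> ball y0 e)"
    proof (rule has_derivative_partialsI[where f = "\<lambda>t y. f (\<Psi> (t, y))"
          and fy = "\<lambda>t y. blinfun_scaleR_left (D n (\<Psi> (t, y)))"])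
      show "((\<lambda>t. f (\<Psi> (t, y0))) has_derivative (\<lambda>ht. ht * (\<Sum>i<n. D i (\<xi> t0) * \<mu>' i))) (at t0 within X)"
        using Suc.IH[OF Suc_leD[OF Suc.prems]] unfolding self has_real_derivative_iff_has_derivative
        by (rule has_derivative_at_withinI)
    next
      fix t y assume ty: "t \<in> X" "y \<in> ball y0 e"
      have "\<Psi> (t, y) \<in> U" using in_U e ty by blast
      from partial[OF _ this, of n] Suc.prems
      have "((\<lambda>y. f (\<Psi> (t, y))) has_real_derivative D n (\<Psi> (t, y))) (at y)"
        by (simp add: \<Psi>_def)
      then show "((\<lambda>y. f (\<Psi> (t, y))) has_derivative blinfun_apply (blinfun_scaleR_left (D n (\<Psi> (t, y))))) (at y within ball y0 e)"
        unfolding has_real_derivative_iff_has_derivative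
        by (simp add: has_derivative_at_withinI)
    next
      have "((\<lambda>p. D n (\<Psi> p)) \<longlongrightarrow> D n (\<xi> t0)) (at (t0, y0) within X \<times> ball y0 e)"
      proof (rule continuous_on_tendsto_compose[OF cont _ U(2)])
        show "(\<Psi> \<longlongrightarrow> \<xi> t0) (at (t0, y0) within X \<times> ball y0 e)"
          using \<Psi>_lim by (rule tendsto_mono[OF at_within_le_nhds])
        show "\<forall>\<^sub>F p in at (t0, y0) within X \<times> ball y0 e. \<Psi> p \<in> U"
          unfolding eventually_at_filter using in_U e(2) by (intro always_eventually) auto
      qed (use Suc.prems in auto)
      then have "continuous (at (t0, y0) within X \<times> ball y0 e) (\<lambda>p. D n (\<Psi> p))"
        by (simp add: continuous_within self self0)
      then show "continuous (at (t0, y0) within X \<times> ball y0 e) (\<lambda>(t, y). blinfun_scaleR_left (D n (\<Psi> (t, y))))"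
        unfolding case_prod_beta prod.collapse
        by (rule bounded_linear.continuous[OF bounded_linear_blinfun_scaleR_left])
    qed (use e in auto)
    moreover have "at (t0, y0) within X \<times> ball y0 e = at (t0, y0)"
      using XY e \<open>t0 \<in> X\<close> by (intro at_within_open open_Times) auto
    ultimately have diff: "((\<lambda>p. f (\<Psi> p)) has_derivative (\<lambda>h. fst h * (\<Sum>i<n. D i (\<xi> t0) * \<mu>' i) +
        snd h * D n (\<xi> t0))) (at (t0, y0))"
      unfolding case_prod_beta prod.collapse self self0 blinfun_scaleR_left.rep_eq by simp
    have "((\<lambda>t. (t, \<mu> n t)) has_derivative (\<lambda>h. (h, h * \<mu>' n))) (at t0)"
      using \<mu>[of n] Suc.prems unfolding has_real_derivative_iff_has_derivative
      by (intro has_derivative_Pair has_derivative_ident) simp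
    from has_derivative_compose[OF this diff[unfolded y0_def]]
    have "((\<lambda>t. f (\<Psi> (t, \<mu> n t))) has_derivative
       (\<lambda>h. h * (\<Sum>i<n. D i (\<xi> t0) * \<mu>' i) + h * \<mu>' n * D n (\<xi> t0))) (at t0)"
      by simp
    moreover have "\<Psi> (t, \<mu> n t) = \<eta> (Suc n) t" for t
      by (auto simp: \<Psi>_def \<eta>_def less_Suc_eq)
    ultimately show ?case
      by (simp add: has_real_derivative_iff_has_derivative algebra_simps)
  qed
  from this[of s] show ?thesis
    by (simp add: \<eta>_def \<xi>_def cong: if_cong)
qed

text \<open>
  The chain rule turns the $\theta$-derivative into a sum of products of partial derivatives of $F$,
  composed with the same functions, and of the tame functions $\theta m_i$. The former are covered
  by the induction hypothesis, and the latter supply the limit 0.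
\<close>

lemma tame_compose:
  fixes m :: "nat \<Rightarrow> real \<times> real \<times> 'p::euclidean_space \<Rightarrow> real"
  assumes U: "openin (Euclidean_space s) U" "(\<lambda>_. 0) \<in> U" and W: "open W" "x0 \<in> W"
    and in_U: "\<forall>\<^sub>F z in corner x0. (\<lambda>i. if i < s then m i z else 0) \<in> U"
  shows "Ck_on_prod k s U W F \<Longrightarrow> (\<And>i. i < s \<Longrightarrow> tame x0 k (m i) 0) \<Longrightarrow>
    tame x0 k (\<lambda>z. F (\<lambda>i. if i < s then m i z else 0) (snd (snd z))) (F (\<lambda>_. 0) x0)"
proof (induction k arbitrary: F)
  define \<xi> where "\<xi> z = (\<lambda>i. if i < s then m i z else 0)" for z
  have in_W: "\<forall>\<^sub>F z in corner x0. snd (snd z) \<in> W"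
    using W by (intro topological_tendstoD[OF tendsto_param_corner])
  have in_U': "\<forall>\<^sub>F z in corner x0. \<xi> z \<in> U"
    using in_U by (simp add: \<xi>_def)
  have lim: "((\<lambda>z. F (\<xi> z) (snd (snd z))) \<longlongrightarrow> F (\<lambda>_. 0) x0) (corner x0)"
    if "continuous_on (U \<times> W) (\<lambda>(\<xi>, x). F \<xi> x)" "\<And>i. i < s \<Longrightarrow> (m i \<longlongrightarrow> 0) (corner x0)" for F
  proof -
    have "((\<lambda>z. \<xi> z i) \<longlongrightarrow> 0) (corner x0)" for i
      using that(2)[of i] by (cases "i < s") (simp_all add: \<xi>_def)
    then have "(\<xi> \<longlongrightarrow> (\<lambda>_. 0)) (corner x0)"
      by (rule tendsto_fun_componentwise)
    then have "((\<lambda>z. (\<xi> z, snd (snd z))) \<longlongrightarrow> ((\<lambda>_. 0), x0)) (corner x0)"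
      by (intro tendsto_Pair tendsto_param_corner)
    moreover have "\<forall>\<^sub>F z in corner x0. (\<xi> z, snd (snd z)) \<in> U \<times> W"
      using in_U' in_W by eventually_elim simp
    ultimately have "((\<lambda>z. (\<lambda>(\<xi>, x). F \<xi> x) (\<xi> z, snd (snd z))) \<longlongrightarrow> (\<lambda>(\<xi>, x). F \<xi> x) ((\<lambda>_. 0), x0)) (corner x0)"
      using U W by (intro continuous_on_tendsto_compose[OF that(1)]) auto
    then show ?thesis by simp
  qed
  {
    case 0
    then show ?case using lim[of F] by (simp add: \<xi>_def)
  next
    case (Suc k)
    define D where "D i \<xi> x = deriv (\<lambda>t. F (\<xi>(i := t)) x) (\<xi> i)" for i \<xi> x
    have cont: "continuous_on (U \<times> W) (\<lambda>(\<xi>, x). F \<xi> x)"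
      and D: "\<And>i \<eta> x. i < s \<Longrightarrow> \<eta> \<in> U \<Longrightarrow> x \<in> W \<Longrightarrow>
         ((\<lambda>t. F (\<eta>(i := t)) x) has_real_derivative D i \<eta> x) (at (\<eta> i))"
      and CkD: "\<And>i. i < s \<Longrightarrow> Ck_on_prod k s U W (D i)"
      using Suc.prems(1) by (auto simp: D_def[abs_def] DERIV_deriv_iff_field_differentiable)
    have contD: "continuous_on (U \<times> W) (\<lambda>(\<xi>, x). D i \<xi> x)" if "i < s" for i
      using CkD[OF that] by (cases k) auto
    have "\<forall>i\<in>{..<s}. \<exists>m'. (\<forall>\<^sub>F z in corner x0. euler_deriv (m i) z (m' z)) \<and> tame x0 k m' 0"
      using Suc.prems(2) by simp
    then obtain m' where m': "\<And>i. i < s \<Longrightarrow> \<forall>\<^sub>F z in corner x0. euler_deriv (m i) z (m' i z)"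
      "\<And>i. i < s \<Longrightarrow> tame x0 k (m' i) 0"
      by (metis lessThan_iff)
    have "\<forall>\<^sub>F z in corner x0. \<forall>i\<in>{..<s}. euler_deriv (m i) z (m' i z)"
      using m'(1) by (intro eventually_ball_finite) auto
    then have "\<forall>\<^sub>F z in corner x0. euler_deriv (\<lambda>z. F (\<xi> z) (snd (snd z))) z (\<Sum>i<s. D i (\<xi> z) (snd (snd z)) * m' i z)"
      using in_U' in_W eventually_corner_positive
    proof eventually_elim
      case (elim z)
      define x where "x = snd (snd z)"
      have curve: "on_curve z (fst z) = z" "snd (snd (on_curve z t)) = x" for t
        using elim by (auto simp: on_curve_self) (simp add: on_curve_def x_def)
      have "((\<lambda>t. F (\<lambda>i. if i < s then m i (on_curve z t) else 0) x) has_real_derivative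
          (\<Sum>i<s. D i (\<lambda>i. if i < s then m i (on_curve z (fst z)) else 0) x * (m' i z / fst z))) (at (fst z))"
      proof (rule DERIV_compose_partials[OF U(1), where D = "\<lambda>i \<xi>. D i \<xi> x"])
        show "(\<lambda>i. if i < s then m i (on_curve z (fst z)) else 0) \<in> U"
          using elim unfolding curve \<xi>_def by simp
        show "((\<lambda>y. F (\<eta>(i := y)) x) has_real_derivative D i \<eta> x) (at (\<eta> i))" if "i < s" "\<eta> \<in> U" for i \<eta>
          using D that elim by (simp add: x_def)
        show "continuous_on U (\<lambda>\<xi>. D i \<xi> x)" if "i < s" for i
        proof -
          have "continuous_on U (\<lambda>\<xi>. (\<lambda>(\<xi>, x). D i \<xi> x) (\<xi>, x))"
            by (rule continuous_on_compose2[OF contD[OF that]])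
               (use elim in \<open>auto intro!: continuous_intros simp: x_def\<close>)
          then show ?thesis by simp
        qed
        show "((\<lambda>t. m i (on_curve z t)) has_real_derivative m' i z / fst z) (at (fst z))" if "i < s" for i
          using elim that by (simp add: euler_deriv_def)
      qed
      from this[unfolded curve] show ?case
        by (simp add: euler_deriv_def curve(2) \<xi>_def sum_divide_distrib x_def[symmetric])
    qed
    moreover have "tame x0 k (\<lambda>z. \<Sum>i<s. D i (\<xi> z) (snd (snd z)) * m' i z) (\<Sum>i<s. D i (\<lambda>_. 0) x0 * 0)"
      unfolding \<xi>_def
      by (intro tame_sum tame_mult Suc.IH CkD m'(2)) (auto intro: tame_Suc_imp_tame[OF Suc.prems(2)] simp del: tame.simps)
    moreover have "((\<lambda>z. F (\<xi> z) (snd (snd z))) \<longlongrightarrow> F (\<lambda>_. 0) x0) (corner x0)"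
      using Suc.prems(2) by (intro lim cont) (auto intro: tame_imp_tendsto simp del: tame.simps)
    ultimately show ?case
      by (auto simp: \<xi>_def)
  }
qed

lemma Ck_on_monomials_imp_tame:
  assumes "Ck_on_monomials k r1 \<rho>1 B x0 g" "order_o1 x0 g" "0 < r1" "0 < \<rho>1" "x0 \<in> interior B"
  shows "tame x0 k (\<lambda>z. g (fst z) (fst (snd z)) (snd (snd z))) 0"
proof -
  obtain s m U W F where
    m: "\<And>i. i < s \<Longrightarrow> primary_monomial r1 \<rho>1 B x0 (m i)" and
    U: "openin (Euclidean_space s) U" "(\<lambda>_. 0) \<in> U" and W: "open W" "B \<subseteq> W" and
    F: "Ck_on_prod k s U W F" and
    g: "\<And>r \<rho> x. 0 \<le> r \<Longrightarrow> r \<le> r1 \<Longrightarrow> 0 \<le> \<rho> \<Longrightarrow> \<rho> \<le> \<rho>1 \<Longrightarrow> x \<in> B \<Longrightarrow>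
           (\<lambda>i. if i < s then m i r \<rho> x else 0) \<in> U \<and>
           g r \<rho> x = F (\<lambda>i. if i < s then m i r \<rho> x else 0) x"
    using assms(1) unfolding Ck_on_monomials_def by force
  obtain d where d: "d > 0" "ball x0 d \<subseteq> B"
    using assms(5) by (meson mem_interior)
  have "x0 \<in> B" using d by auto
  with W have x0: "x0 \<in> B" "x0 \<in> W" by auto
  let ?\<xi> = "\<lambda>z i. if i < s then m i (fst z) (fst (snd z)) (snd (snd z)) else 0"
  have dom: "\<forall>\<^sub>F z in corner x0. 0 \<le> fst z \<and> fst z \<le> r1 \<and> 0 \<le> fst (snd z) \<and> fst (snd z) \<le> \<rho>1 \<and> snd (snd z) \<in> B"
    unfolding eventually_corner
    by (rule exI[of _ "min d (min r1 \<rho>1)"]) (use d assms in \<open>auto simp: subset_iff dist_commute\<close>)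
  have in_U: "\<forall>\<^sub>F z in corner x0. ?\<xi> z \<in> U"
    using dom by eventually_elim (use g in blast)
  have eq: "\<forall>\<^sub>F z in corner x0. F (?\<xi> z) (snd (snd z)) = g (fst z) (fst (snd z)) (snd (snd z))"
    using dom by eventually_elim (use g in auto)
  have "(\<lambda>i. if i < s then m i 0 0 x0 else 0) = (\<lambda>_. 0)"
    using m unfolding primary_monomial_def by auto
  then have "F (\<lambda>_. 0) x0 = 0"
    using g[of 0 0 x0] assms x0 by (simp add: order_o1_def)
  moreover have "tame x0 k (\<lambda>z. F (?\<xi> z) (snd (snd z))) (F (\<lambda>_. 0) x0)"
    using assms by (intro tame_compose[OF U W(1) x0(2) in_U F] tame_primary_monomial[OF m]) auto
  ultimately show ?thesis
    using tame_cong[OF eq] by simp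
qed

text \<open>
  The compensators have exponent 0, so only $r$ and $\rho$ contribute, with exponents 1 and
  $-1$.
\<close>

lemma log_tame_general_monomial_omega:
  assumes "x0 \<in> B" "finite J" "\<And>j. j \<in> J \<Longrightarrow> smooth_on B (\<gamma> j) \<and> \<gamma> j x0 = 0"
    and "smooth_on B a" "smooth_on B b" "\<And>j. j \<in> J \<Longrightarrow> smooth_on B (c j)"
  shows "log_tame x0 k (\<lambda>z. general_monomial_omega a b J \<gamma> c (fst z) (fst (snd z)) (snd (snd z))) (a x0 - b x0)"
proof -
  have pos: "\<forall>\<^sub>F z in corner x0. 0 < fst z" "\<forall>\<^sub>F z in corner x0. 0 < fst (snd z)"
     "\<And>\<gamma>. \<forall>\<^sub>F z in corner x0. 0 < omega (fst z) (\<gamma> (snd (snd z)))"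
    using eventually_corner_positive by (eventually_elim; simp add: omega_pos)+
  note lim = smooth_on_imp_tendsto[OF _ assms(1)]
  have lim0: "(\<gamma> j \<longlongrightarrow> 0) (nhds x0)" if "j \<in> J" for j
    using lim[of "\<gamma> j"] assms(3)[OF that] by simp
  have "log_tame x0 k (\<lambda>z. fst z powr a (snd (snd z)) * fst (snd z) powr b (snd (snd z)) *
      (\<Prod>j\<in>J. omega (fst z) (\<gamma> j (snd (snd z))) powr c j (snd (snd z))))
      (a x0 * 1 + b x0 * -1 + (\<Sum>j\<in>J. c j x0 * 0))"
    by (intro log_tame_mult log_tame_prod log_tame_powr log_tame_r log_tame_rho log_tame_omega pos lim lim0 assms)
  then show ?thesis
    by (simp add: general_monomial_omega_def)
qed

section \<open>Zeros of functions of one variable, with multiplicity\<close>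

text \<open>
  Differentiability to order \<open>n\<close> near a point is stated through the existence of derivative functions.
  This is easier to combine than the iterated operator \<open>deriv\<close>, because sums and products
  of such derivative functions can be written down explicitly.
\<close>

primrec smooth_at :: "nat \<Rightarrow> (real \<Rightarrow> real) \<Rightarrow> real \<Rightarrow> bool" where
  "smooth_at 0 h t \<longleftrightarrow> True"
| "smooth_at (Suc n) h t \<longleftrightarrow>
     (\<exists>h'. (\<forall>\<^sub>F s in nhds t. (h has_real_derivative h' s) (at s)) \<and> smooth_at n h' t)"

text \<open>
  A zero of order at least \<open>n\<close>. Only \<open>n\<close> derivatives near the point are
  required.
\<close>

primrec zero_of_order :: "nat \<Rightarrow> (real \<Rightarrow> real) \<Rightarrow> real \<Rightarrow> bool" where
  "zero_of_order 0 h t \<longleftrightarrow> True"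
| "zero_of_order (Suc n) h t \<longleftrightarrow> h t = 0 \<and>
     (\<exists>h'. (\<forall>\<^sub>F s in nhds t. (h has_real_derivative h' s) (at s)) \<and> zero_of_order n h' t)"

lemma eventually_DERIV_cong:
  assumes "\<forall>\<^sub>F s in nhds t. f s = g s" "\<forall>\<^sub>F s in nhds t. (f has_real_derivative h s) (at s)"
  shows "\<forall>\<^sub>F s in nhds t. (g has_real_derivative h s) (at s)"
proof -
  have "\<forall>\<^sub>F s in nhds t. \<forall>\<^sub>F r in nhds s. f r = g r"
    using assms(1) by (simp add: eventually_eventually)
  with assms(2) show ?thesis
    by eventually_elim (use DERIV_cong_ev in blast)
qed

lemma smooth_at_Suc_imp: "smooth_at (Suc n) h t \<Longrightarrow> smooth_at n h t"
  by (induction n arbitrary: h) auto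

lemma smooth_at_antimono: "n \<le> k \<Longrightarrow> smooth_at k h t \<Longrightarrow> smooth_at n h t"
  by (induction k rule: dec_induct) (auto dest: smooth_at_Suc_imp simp del: smooth_at.simps)

lemma smooth_at_cong:
  assumes "\<forall>\<^sub>F s in nhds t. f s = g s" "smooth_at n f t"
  shows "smooth_at n g t"
  using assms eventually_DERIV_cong[OF assms(1)] by (cases n) auto

lemma smooth_at_const: "smooth_at n (\<lambda>_. c) t"
  by (induction n arbitrary: c) (auto intro!: exI[of _ "\<lambda>_. 0"])

lemma smooth_at_ident: "smooth_at n (\<lambda>s. s) t"
  by (cases n) (auto intro!: exI[of _ "\<lambda>_. 1"] smooth_at_const)

lemma smooth_at_add: "smooth_at n f t \<Longrightarrow> smooth_at n g t \<Longrightarrow> smooth_at n (\<lambda>s. f s + g s) t"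
proof (induction n arbitrary: f g)
  case (Suc n)
  then obtain f' g' where fg: "\<forall>\<^sub>F s in nhds t. (f has_real_derivative f' s) (at s)" "smooth_at n f' t"
    "\<forall>\<^sub>F s in nhds t. (g has_real_derivative g' s) (at s)" "smooth_at n g' t" by auto
  have "\<forall>\<^sub>F s in nhds t. ((\<lambda>s. f s + g s) has_real_derivative f' s + g' s) (at s)"
    using fg(1,3) by eventually_elim (rule DERIV_add)
  with Suc.IH[OF fg(2,4)] show ?case by auto
qed simp

lemma smooth_at_mult: "smooth_at n f t \<Longrightarrow> smooth_at n g t \<Longrightarrow> smooth_at n (\<lambda>s. f s * g s) t"
proof (induction n arbitrary: f g)
  case (Suc n)
  then obtain f' g' where fg: "\<forall>\<^sub>F s in nhds t. (f has_real_derivative f' s) (at s)" "smooth_at n f' t"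
    "\<forall>\<^sub>F s in nhds t. (g has_real_derivative g' s) (at s)" "smooth_at n g' t" by auto
  have "\<forall>\<^sub>F s in nhds t. ((\<lambda>s. f s * g s) has_real_derivative f' s * g s + g' s * f s) (at s)"
    using fg(1,3) by eventually_elim (rule DERIV_mult)
  moreover have "smooth_at n (\<lambda>s. f' s * g s + g' s * f s) t"
    by (intro smooth_at_add Suc.IH fg smooth_at_Suc_imp[OF Suc.prems(1)] smooth_at_Suc_imp[OF Suc.prems(2)])
  ultimately show ?case by auto
qed simp

lemma smooth_at_sum:
  "finite S \<Longrightarrow> (\<And>i. i \<in> S \<Longrightarrow> smooth_at n (f i) t) \<Longrightarrow> smooth_at n (\<lambda>s. \<Sum>i\<in>S. f i s) t"
  by (induction S rule: finite_induct) (simp_all add: smooth_at_const smooth_at_add)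

lemma smooth_at_inverse_ident: "t \<noteq> 0 \<Longrightarrow> smooth_at n inverse t"
proof (induction n)
  case (Suc n)
  have "\<forall>\<^sub>F s in nhds t. s \<noteq> 0"
    using Suc.prems by (auto intro: tendsto_imp_eventually_ne[OF filterlim_ident])
  then have "\<forall>\<^sub>F s in nhds t. (inverse has_real_derivative - 1 * (inverse s * inverse s)) (at s)"
    by eventually_elim (use DERIV_inverse in \<open>auto simp: power2_eq_square\<close>)
  moreover have "smooth_at n (\<lambda>s. - 1 * (inverse s * inverse s)) t"
    using Suc by (intro smooth_at_mult smooth_at_const) auto
  ultimately show ?case
    unfolding smooth_at.simps by (intro exI[of _ "\<lambda>s. - 1 * (inverse s * inverse s)"] conjI)
qed simp

lemma zero_of_order_Suc_imp: "zero_of_order (Suc n) h t \<Longrightarrow> zero_of_order n h t"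
  by (induction n arbitrary: h) auto

lemma zero_of_order_antimono: "n \<le> k \<Longrightarrow> zero_of_order k h t \<Longrightarrow> zero_of_order n h t"
  by (induction k rule: dec_induct) (auto dest: zero_of_order_Suc_imp simp del: zero_of_order.simps)

lemma zero_of_order_cong:
  assumes "\<forall>\<^sub>F s in nhds t. f s = g s" "zero_of_order n f t"
  shows "zero_of_order n g t"
  using assms eventually_DERIV_cong[OF assms(1)] eventually_nhds_x_imp_x[OF assms(1)] by (cases n) auto

lemma zero_of_order_add:
  "zero_of_order n f t \<Longrightarrow> zero_of_order n g t \<Longrightarrow> zero_of_order n (\<lambda>s. f s + g s) t"
proof (induction n arbitrary: f g)
  case (Suc n)
  then obtain f' g' where fg: "\<forall>\<^sub>F s in nhds t. (f has_real_derivative f' s) (at s)" "zero_of_order n f' t"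
    "\<forall>\<^sub>F s in nhds t. (g has_real_derivative g' s) (at s)" "zero_of_order n g' t" by auto
  have "\<forall>\<^sub>F s in nhds t. ((\<lambda>s. f s + g s) has_real_derivative f' s + g' s) (at s)"
    using fg(1,3) by eventually_elim (rule DERIV_add)
  with Suc.IH[OF fg(2,4)] Suc.prems show ?case by auto
qed simp

lemma zero_of_order_mult:
  "smooth_at n u t \<Longrightarrow> zero_of_order n h t \<Longrightarrow> zero_of_order n (\<lambda>s. u s * h s) t"
proof (induction n arbitrary: u h)
  case (Suc n)
  then obtain u' h' where uh: "\<forall>\<^sub>F s in nhds t. (u has_real_derivative u' s) (at s)" "smooth_at n u' t"
    "\<forall>\<^sub>F s in nhds t. (h has_real_derivative h' s) (at s)" "zero_of_order n h' t" by auto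
  have "\<forall>\<^sub>F s in nhds t. ((\<lambda>s. u s * h s) has_real_derivative u' s * h s + u s * h' s) (at s)"
    using uh(1,3) by eventually_elim (metis DERIV_mult mult.commute)
  moreover have "zero_of_order n (\<lambda>s. u' s * h s + u s * h' s) t"
    by (intro zero_of_order_add Suc.IH uh smooth_at_Suc_imp[OF Suc.prems(1)] zero_of_order_Suc_imp[OF Suc.prems(2)])
  ultimately show ?case using Suc.prems by auto
qed simp

lemma zero_of_order_deriv:
  assumes "zero_of_order (Suc n) h t" "\<forall>\<^sub>F s in nhds t. (h has_real_derivative h' s) (at s)"
  shows "zero_of_order n h' t"
proof -
  obtain k where k: "\<forall>\<^sub>F s in nhds t. (h has_real_derivative k s) (at s)" "zero_of_order n k t"
    using assms(1) by auto
  have "\<forall>\<^sub>F s in nhds t. k s = h' s"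
    using k(1) assms(2) by eventually_elim (rule DERIV_unique)
  then show ?thesis using k(2) by (rule zero_of_order_cong)
qed

lemma zero_of_order_if_higher_deriv:
  "smooth_at n h t \<Longrightarrow> (\<And>j. j < n \<Longrightarrow> (deriv ^^ j) h t = 0) \<Longrightarrow> zero_of_order n h t"
proof (induction n arbitrary: h)
  case (Suc n)
  then obtain h' where h': "\<forall>\<^sub>F s in nhds t. (h has_real_derivative h' s) (at s)" "smooth_at n h' t"
    by auto
  have eq: "\<forall>\<^sub>F s in nhds t. deriv h s = h' s"
    using h'(1) by eventually_elim (rule DERIV_imp_deriv)
  have "(deriv ^^ j) h' t = 0" if "j < n" for j
    using Suc.prems(2)[of "Suc j"] that higher_deriv_cong_ev[OF eq refl, of j]
    by (simp add: funpow_Suc_right del: funpow.simps)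
  then have "zero_of_order n h' t"
    by (rule Suc.IH[OF h'(2)])
  with h'(1) Suc.prems(2)[of 0] show ?case by auto
qed simp

text \<open>
  Zeros are counted by arbitrary finite sets, with arbitrary lower bounds for the orders. This form
  includes the finiteness of the set of zeros and does not depend on the exact multiplicities.
\<close>

definition at_most_zeros :: "nat \<Rightarrow> real set \<Rightarrow> (real \<Rightarrow> real) \<Rightarrow> bool" where
  "at_most_zeros N I h \<longleftrightarrow>
     (\<forall>Z m. finite Z \<longrightarrow> Z \<subseteq> I \<longrightarrow> (\<forall>z\<in>Z. zero_of_order (m z) h z) \<longrightarrow> sum m Z \<le> N)"

lemma at_most_zeros_cong:
  assumes "open I" "\<And>t. t \<in> I \<Longrightarrow> f t = g t" "at_most_zeros N I f"
  shows "at_most_zeros N I g"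
proof -
  have "zero_of_order n f z" if "z \<in> I" "zero_of_order n g z" for n z
  proof (rule zero_of_order_cong[OF _ that(2)])
    show "\<forall>\<^sub>F s in nhds z. g s = f s"
      using assms(1,2) that(1) unfolding eventually_nhds by metis
  qed
  then show ?thesis
    using assms(3) unfolding at_most_zeros_def by (meson subsetD)
qed

lemma at_most_zeros_nonvanishing:
  assumes "\<And>t. t \<in> I \<Longrightarrow> h t \<noteq> 0"
  shows "at_most_zeros N I h"
proof -
  have "m z = 0" if "z \<in> I" "zero_of_order (m z) h z" for m :: "real \<Rightarrow> nat" and z
    using that assms by (cases "m z") auto
  then show ?thesis
    unfolding at_most_zeros_def by (metis le0 subsetD sum.neutral)
qed

text \<open>
  Used to cut off the orders of zeros, so that no more derivatives are involved than exist.
\<close>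

lemma exists_smaller_with_sum:
  fixes m :: "'a \<Rightarrow> nat"
  assumes "finite Z" "K \<le> sum m Z"
  shows "\<exists>m'. (\<forall>z\<in>Z. m' z \<le> m z) \<and> sum m' Z = K"
  using assms
proof (induction Z arbitrary: K rule: finite_induct)
  case (insert a Z)
  obtain m' where m': "\<forall>z\<in>Z. m' z \<le> m z" "sum m' Z = min K (sum m Z)"
    using insert.IH[of "min K (sum m Z)"] by auto
  define m'' where "m'' = m'(a := K - min K (sum m Z))"
  have "sum m'' Z = sum m' Z"
    using insert.hyps by (intro sum.cong) (auto simp: m''_def)
  then have "sum m'' (insert a Z) = K"
    using insert.hyps m'(2) by (simp add: m''_def)
  moreover have "\<forall>z\<in>insert a Z. m'' z \<le> m z"
    using m'(1) insert by (auto simp: m''_def)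
  ultimately show ?case by blast
qed simp

lemma Rolle_interlacing:
  fixes a b :: real
  assumes "finite Z" "Z \<noteq> {}" "Z \<subseteq> {a<..<b}" "\<And>z. z \<in> Z \<Longrightarrow> q z = 0"
    and "\<And>t. t \<in> {a<..<b} \<Longrightarrow> (q has_real_derivative q' t) (at t)"
  shows "\<exists>W. finite W \<and> W \<subseteq> {a<..<b} \<and> W \<inter> Z = {} \<and> Suc (card W) = card Z \<and>
           (\<forall>w\<in>W. q' w = 0 \<and> w < Max Z)"
  using assms(1-4)
proof (induction Z rule: finite_linorder_max_induct)
  case (insert c Z)
  show ?case
  proof (cases "Z = {}")
    case True
    then show ?thesis by (intro exI[of _ "{}"]) auto
  next
    case False
    then obtain W where W: "finite W" "W \<subseteq> {a<..<b}" "W \<inter> Z = {}" "Suc (card W) = card Z"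
        "\<forall>w\<in>W. q' w = 0 \<and> w < Max Z"
      using insert by auto
    have Max: "Max Z \<in> Z" "Max Z < c"
      using insert False by auto
    have "\<exists>w. Max Z < w \<and> w < c \<and> (q has_real_derivative 0) (at w)"
    proof (rule Rolle)
      show "continuous_on {Max Z..c} q"
        using insert.prems Max
        by (intro continuous_at_imp_continuous_on ballI DERIV_isCont[OF assms(5)]) auto
      show "q differentiable at x" if "Max Z < x" "x < c" for x
      proof -
        have "x \<in> {a<..<b}" using that insert.prems Max by auto
        then show ?thesis
          using assms(5) real_differentiable_def by blast
      qed
    qed (use Max insert in auto)
    then obtain w where w: "Max Z < w" "w < c" "(q has_real_derivative 0) (at w)" by blast
    have "w \<in> {a<..<b}"
      using w insert.prems Max by auto
    then have "q' w = 0"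
      using DERIV_unique[OF w(3) assms(5)] by simp
    moreover have "w \<notin> W" using W(5) w by auto
    moreover have "w \<notin> Z"
      using w insert.hyps by (meson Max_ge leD)
    moreover have "Max (insert c Z) = c"
      using insert.hyps by (intro Max_eqI) (auto intro: less_imp_le)
    ultimately show ?thesis
      using W w Max insert.hyps \<open>w \<in> {a<..<b}\<close>
      by (intro exI[of _ "insert w W"]) (auto)
  qed
qed simp

text \<open>
  Multiplication by the smooth factor $u$ preserves the orders of zeros. Differentiation lowers the
  order at each zero by one, and Rolle's theorem yields a new simple zero between any two consecutive
  ones; so altogether the count drops by at most one. The division by $t$ in the hypothesis
  matches the Euler field, and the factor $1/t$ does not change zeros for $t > 0$.
\<close>

lemma at_most_zeros_Suc_if_deriv:
  fixes a b :: real
  assumes "0 \<le> a" "at_most_zeros N {a<..<b} g" "\<And>t. t \<in> {a<..<b} \<Longrightarrow> smooth_at 1 g t"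
    and u: "\<And>t. t \<in> {a<..<b} \<Longrightarrow> smooth_at (Suc (Suc N)) u t"
    and deriv: "\<And>t. t \<in> {a<..<b} \<Longrightarrow> ((\<lambda>s. u s * h s) has_real_derivative g t / t) (at t)"
  shows "at_most_zeros (Suc N) {a<..<b} h"
  unfolding at_most_zeros_def
proof (intro allI impI, rule ccontr)
  fix Z and m0 :: "real \<Rightarrow> nat"
  assume Z: "finite Z" "Z \<subseteq> {a<..<b}" and zero0: "\<forall>z\<in>Z. zero_of_order (m0 z) h z"
    and "\<not> sum m0 Z \<le> Suc N"
  then have "Suc (Suc N) \<le> sum m0 Z" by simp
  \<comment> \<open>Orders above $N + 2$ would need more smoothness of $u$ than there is.\<close>
  from exists_smaller_with_sum[OF Z(1) this] obtain m
    where m: "\<forall>z\<in>Z. m z \<le> m0 z" "sum m Z = Suc (Suc N)" by blast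
  let ?I = "{a<..<b}" and ?q = "\<lambda>s. u s * h s" and ?q' = "\<lambda>t. g t / t"
  have deriv_ev: "\<forall>\<^sub>F s in nhds t. (?q has_real_derivative ?q' s) (at s)" if "t \<in> ?I" for t
    using deriv that unfolding eventually_nhds by (intro exI[of _ ?I]) auto
  have zero: "zero_of_order (m z) ?q z" if "z \<in> Z" for z
  proof (rule zero_of_order_mult)
    have "m z \<le> Suc (Suc N)"
      using member_le_sum[OF that, of m] Z m by simp
    then show "smooth_at (m z) u z"
      using u Z that by (meson smooth_at_antimono subsetD)
    show "zero_of_order (m z) h z"
      using m zero0 that zero_of_order_antimono by blast
  qed
  define P where "P = {z \<in> Z. m z > 0}"
  have P: "finite P" "P \<subseteq> ?I" using Z by (auto simp: P_def)
  have sumP: "sum m P = Suc (Suc N)"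
    unfolding m(2)[symmetric] using Z(1) by (intro sum.mono_neutral_left) (auto simp: P_def)
  then have "P \<noteq> {}" by auto
  have "?q z = 0" if "z \<in> P" for z
    using zero[of z] that unfolding P_def by (cases "m z") auto
  then obtain W where W: "finite W" "W \<subseteq> ?I" "W \<inter> P = {}" "Suc (card W) = card P" "\<forall>w\<in>W. ?q' w = 0"
    using Rolle_interlacing[OF P(1) \<open>P \<noteq> {}\<close> P(2), of ?q ?q'] deriv by blast
  \<comment> \<open>The old zeros lose one order, and the intermediate zeros are simple.\<close>
  define m' where "m' z = (if z \<in> P then m z - 1 else 1)" for z
  have zero': "zero_of_order (m' z) g z" if "z \<in> P \<union> W" for z
  proof (cases "z \<in> P")
    case True
    then have z: "z \<in> ?I" "m z = Suc (m' z)" "z \<in> Z"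
      using P by (auto simp: m'_def P_def)
    have "zero_of_order (m' z) ?q' z"
      using zero_of_order_deriv[OF _ deriv_ev[OF z(1)]] zero[OF z(3)] z(2) by metis
    then have "zero_of_order (m' z) (\<lambda>s. s * ?q' s) z"
      by (intro zero_of_order_mult smooth_at_ident)
    moreover have "\<forall>\<^sub>F s in nhds z. s * ?q' s = g s"
      unfolding eventually_nhds using z(1) \<open>0 \<le> a\<close> by (intro exI[of _ ?I]) auto
    ultimately show ?thesis by (rule zero_of_order_cong[rotated])
  next
    case False
    then have "z \<in> W" using that by auto
    then have "z \<in> ?I" "g z = 0"
      using W \<open>0 \<le> a\<close> by force+
    then show ?thesis
      using assms(3)[of z] False by (auto simp: m'_def)
  qed
  have "sum m' W = (\<Sum>w\<in>W. 1)"
    using W(3) by (intro sum.cong) (auto simp: m'_def)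
  then have "sum m' (P \<union> W) = sum m' P + card W"
    using P W by (subst sum.union_disjoint) auto
  moreover have "sum m' P + card P = sum m P"
    unfolding card_eq_sum sum.distrib[symmetric] by (intro sum.cong) (auto simp: m'_def P_def)
  ultimately have "sum m' (P \<union> W) = Suc N"
    using sumP W(4) by linarith
  moreover have "sum m' (P \<union> W) \<le> N"
    using assms(2)[unfolded at_most_zeros_def, rule_format, of "P \<union> W" m'] P W zero' by blast
  ultimately show False by simp
qed

text \<open>
  A multiplicity larger than $N$ is impossible, because $N + 1$ derivatives exist and would give a
  zero of order $N + 1$. Hence all multiplicities are finite, and they are orders of zeros.
\<close>

lemma sum_root_multiplicity_le:
  assumes zeros: "at_most_zeros N I h" and smooth: "\<And>t. t \<in> I \<Longrightarrow> smooth_at (Suc N) h t"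
  shows "finite {t \<in> I. h t = 0}" "(\<Sum>t | t \<in> I \<and> h t = 0. root_multiplicity h t) \<le> enat N"
proof -
  let ?R = "{t \<in> I. h t = 0}"
  show fin: "finite ?R"
  proof (rule finite_if_finite_subsets_card_bdd[THEN conjunct1])
    fix Z assume Z: "Z \<subseteq> ?R" "finite Z"
    have "zero_of_order 1 h z" if "z \<in> Z" for z
      using smooth_at_antimono[OF _ smooth, of 1 z] that Z by auto
    then show "card Z \<le> N"
      using zeros[unfolded at_most_zeros_def, rule_format, of Z "\<lambda>_. 1"] Z by auto
  qed
  have "\<exists>n. zero_of_order n h t \<and> root_multiplicity h t \<le> enat n" if t: "t \<in> ?R" for t
  proof -
    define K where "K = {n. \<forall>j<n. (deriv ^^ j) h t = 0}"
    have zero: "zero_of_order n h t" if "n \<in> K" "n \<le> Suc N" for n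
      using that t by (intro zero_of_order_if_higher_deriv smooth_at_antimono[OF _ smooth]) (auto simp: K_def)
    have le: "n \<le> N" if "n \<in> K" for n
    proof (rule ccontr)
      assume "\<not> n \<le> N"
      then have "zero_of_order (Suc N) h t"
        using that by (intro zero) (auto simp: K_def)
      then have "Suc N \<le> N"
        using zeros[unfolded at_most_zeros_def, rule_format, of "{t}" "\<lambda>_. Suc N"] t by simp
      then show False by simp
    qed
    then have finK: "finite K" by (meson finite_nat_set_iff_bounded_le)
    have "0 \<in> K" by (simp add: K_def)
    then have "Max K \<in> K" using finK by (intro Max_in) auto
    moreover have "root_multiplicity h t \<le> enat (Max K)"
      unfolding root_multiplicity_def using finK by (intro Sup_least) (auto simp: K_def)
    ultimately show ?thesis
      using zero le by (meson le_SucI)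
  qed
  then obtain n where n: "\<And>t. t \<in> ?R \<Longrightarrow> zero_of_order (n t) h t \<and> root_multiplicity h t \<le> enat (n t)"
    by metis
  have "(\<Sum>t\<in>?R. root_multiplicity h t) \<le> (\<Sum>t\<in>?R. enat (n t))"
    using n by (intro sum_mono) blast
  also have "\<dots> = enat (sum n ?R)"
    by (simp add: of_nat_eq_enat[symmetric])
  also have "sum n ?R \<le> N"
    using zeros[unfolded at_most_zeros_def, rule_format, of ?R n] n fin by auto
  finally show "(\<Sum>t | t \<in> I \<and> h t = 0. root_multiplicity h t) \<le> enat N"
    by simp
qed

section \<open>Division and derivation\<close>

text \<open>
  In this form smallness of the box is itself an eventual property, so finitely many conditions on
  the size of the box can be imposed together.
\<close>

lemma eventually_corner_boxes:
  assumes "eventually P (corner x0)"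
  shows "\<forall>\<^sub>F \<delta> in at_right 0. \<forall>r \<rho> x. 0 < r \<and> r < \<delta> \<and> 0 < \<rho> \<and> \<rho> < \<delta> \<and> dist x x0 < \<delta> \<longrightarrow> P (r, \<rho>, x)"
proof -
  obtain d where d: "d > 0" "\<And>r \<rho> x. 0 < r \<Longrightarrow> r < d \<Longrightarrow> 0 < \<rho> \<Longrightarrow> \<rho> < d \<Longrightarrow> dist x x0 < d \<Longrightarrow> P (r, \<rho>, x)"
    using assms unfolding eventually_corner by blast
  show ?thesis
    unfolding eventually_at_right_field by (intro exI[of _ d]) (use d in auto)
qed

lemma tame_imp_smooth_at:
  "tame x0 k f L \<Longrightarrow> \<forall>\<^sub>F z in corner x0. smooth_at k (\<lambda>t. f (on_curve z t)) (fst z)"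
proof (induction k arbitrary: f L)
  case (Suc k)
  then obtain f' where f': "\<forall>\<^sub>F z in corner x0. euler_deriv f z (f' z)" "tame x0 k f' 0" by auto
  have "\<forall>\<^sub>F z in corner x0. euler_deriv f z (f' z) \<and> 0 < fst z"
    using f'(1) eventually_corner_positive by eventually_elim simp
  from eventually_corner_along_curve[OF this] Suc.IH[OF f'(2)] eventually_corner_positive
  show ?case
  proof eventually_elim
    case (elim z)
    have "\<forall>\<^sub>F t in nhds (fst z). ((\<lambda>t. f (on_curve z t)) has_real_derivative f' (on_curve z t) * inverse t) (at t)"
      using elim(1)
    proof eventually_elim
      case (elim t)
      then have "t \<noteq> 0" "fst (on_curve z t) = t" by (simp_all add: on_curve_def)
      with elim show ?case by (simp add: euler_deriv_def on_curve_on_curve divide_inverse)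
    qed
    moreover have "smooth_at k (\<lambda>t. f' (on_curve z t) * inverse t) (fst z)"
      using elim by (intro smooth_at_mult smooth_at_inverse_ident) auto
    ultimately show ?case by auto
  qed
qed simp

text \<open>
  From $h' = h p / t$ with $p$ smooth of order $k$, the order of smoothness of $h$ is raised step by
  step up to $k + 1$.
\<close>

lemma log_tame_imp_smooth_at:
  assumes "log_tame x0 k h \<alpha>"
  shows "\<forall>\<^sub>F z in corner x0. smooth_at (Suc k) (\<lambda>t. h (on_curve z t)) (fst z)"
proof -
  obtain p where p: "tame x0 k p \<alpha>" "\<forall>\<^sub>F z in corner x0. h z \<noteq> 0 \<and> euler_deriv h z (h z * p z)"
    using assms unfolding log_tame_def by blast
  have "\<forall>\<^sub>F z in corner x0. euler_deriv h z (h z * p z) \<and> 0 < fst z"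
    using p(2) eventually_corner_positive by eventually_elim simp
  from eventually_corner_along_curve[OF this] tame_imp_smooth_at[OF p(1)] eventually_corner_positive
  show ?thesis
  proof eventually_elim
    case (elim z)
    let ?h = "\<lambda>t. h (on_curve z t)" and ?p = "\<lambda>t. p (on_curve z t)"
    have deriv: "\<forall>\<^sub>F t in nhds (fst z). (?h has_real_derivative ?h t * ?p t * inverse t) (at t)"
      using elim(1)
    proof eventually_elim
      case (elim t)
      then have "t \<noteq> 0" "fst (on_curve z t) = t" by (simp_all add: on_curve_def)
      with elim show ?case by (simp add: euler_deriv_def on_curve_on_curve divide_inverse)
    qed
    have "j \<le> Suc k \<Longrightarrow> smooth_at j ?h (fst z)" for j
    proof (induction j)
      case (Suc j)
      then have "smooth_at j (\<lambda>t. ?h t * ?p t * inverse t) (fst z)"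
        using elim by (intro smooth_at_mult smooth_at_inverse_ident smooth_at_antimono[of j k ?p]) auto
      with deriv show ?case by auto
    qed simp
    then show ?case by blast
  qed
qed

lemma log_tame_antimono: "n \<le> k \<Longrightarrow> log_tame x0 k h \<alpha> \<Longrightarrow> log_tame x0 n h \<alpha>"
  unfolding log_tame_def using tame_antimono by blast

lemma log_tame_imp_nonzero: "log_tame x0 k h \<alpha> \<Longrightarrow> \<forall>\<^sub>F z in corner x0. h z \<noteq> 0"
  unfolding log_tame_def by (auto elim: eventually_mono)


text \<open>
  The division-derivation argument. The induction is on the number of terms. For every possible
  choice $i_0$ of a term with nonzero coefficient, the quotients $u h_i$ with $u = 1/h_{i_0}$ have
  the derivatives $v_i = u h_i (p_i - p_{i_0})$, where $p_i$ is the logarithmic derivative of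
  $h_i$. They are \<open>log_tame\<close> with the shifted exponents $\alpha_i - \alpha_{i_0}$, and $v_{i_0} = 0$, so the
  combination has become shorter. As there are finitely many $i_0$, one box serves for
  all coefficients.
\<close>

proposition eventually_at_most_zeros_combination:
  fixes h :: "'i \<Rightarrow> real \<times> real \<times> 'p::metric_space \<Rightarrow> real"
  assumes "finite S" "card S = Suc N" "inj_on \<alpha> S" "\<And>i. i \<in> S \<Longrightarrow> log_tame x0 N (h i) (\<alpha> i)"
  shows "\<forall>\<^sub>F \<delta> in at_right 0. \<forall>A x \<nu>. 0 < \<nu> \<longrightarrow> dist x x0 < \<delta> \<longrightarrow> (\<exists>i\<in>S. A i \<noteq> 0) \<longrightarrow>
           at_most_zeros N {\<nu> / \<delta><..<\<delta>} (\<lambda>t. \<Sum>i\<in>S. A i * h i (t, \<nu> / t, x))"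
  using assms
proof (induction N arbitrary: S h \<alpha>)
  case 0
  then obtain i where S: "S = {i}"
    by (auto simp: card_Suc_eq)
  have "\<forall>\<^sub>F z in corner x0. h i z \<noteq> 0"
    using 0 S by (intro log_tame_imp_nonzero) auto
  from eventually_corner_boxes[OF this] eventually_at_right_less[of 0] show ?case
  proof eventually_elim
    case (elim \<delta>)
    show ?case
    proof (intro allI impI at_most_zeros_nonvanishing)
      fix A :: "'i \<Rightarrow> real" and x \<nu> t
      assume \<nu>: "0 < \<nu>" and x: "dist x x0 < \<delta>" and A: "\<exists>i\<in>S. A i \<noteq> 0" and t: "t \<in> {\<nu> / \<delta><..<\<delta>}"
      have "0 < \<nu> / \<delta>" using \<nu> elim by simp
      then have "0 < t" using t by simp
      then have "h i (t, \<nu> / t, x) \<noteq> 0"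
        using elim \<nu> x t by (simp add: field_simps)
      then show "(\<Sum>i\<in>S. A i * h i (t, \<nu> / t, x)) \<noteq> 0"
        using A S by simp
    qed
  qed
next
  case (Suc N)
  have "\<forall>i\<in>S. \<exists>p. tame x0 (Suc N) p (\<alpha> i) \<and>
      (\<forall>\<^sub>F z in corner x0. h i z \<noteq> 0 \<and> euler_deriv (h i) z (h i z * p z))"
    using Suc.prems(4) unfolding log_tame_def by blast
  from bchoice[OF this] obtain p
    where p: "\<And>i. i \<in> S \<Longrightarrow> tame x0 (Suc N) (p i) (\<alpha> i)"
      "\<And>i. i \<in> S \<Longrightarrow> \<forall>\<^sub>F z in corner x0. h i z \<noteq> 0 \<and> euler_deriv (h i) z (h i z * p i z)"
    by blast
  have "\<forall>\<^sub>F \<delta> in at_right 0. \<forall>A x \<nu>. 0 < \<nu> \<longrightarrow> dist x x0 < \<delta> \<longrightarrow> A i0 \<noteq> 0 \<longrightarrow>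
           at_most_zeros (Suc N) {\<nu> / \<delta><..<\<delta>} (\<lambda>t. \<Sum>i\<in>S. A i * h i (t, \<nu> / t, x))"
    if i0: "i0 \<in> S" for i0
  proof -
    define S' where "S' = S - {i0}"
    have S': "finite S'" "card S' = Suc N" "S = insert i0 S'" "i0 \<notin> S'"
      using Suc.prems(1,2) i0 by (auto simp: S'_def)
    define u where "u z = inverse (h i0 z)" for z
    define v where "v i z = (u z * h i z) * (p i z - p i0 z)" for i z
    have u: "log_tame x0 (Suc N) u (- \<alpha> i0)"
      unfolding u_def by (intro log_tame_inverse Suc.prems i0)
    \<comment> \<open>The difference $p_i - p_{i_0}$ has a nonzero limit, so it has exponent 0 and does not vanish.\<close>
    have v: "log_tame x0 N (v i) (\<alpha> i - \<alpha> i0)" if "i \<in> S'" for i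
    proof -
      have i: "i \<in> S" "\<alpha> i - \<alpha> i0 \<noteq> 0"
        using that i0 Suc.prems(3) by (auto simp: S'_def inj_on_eq_iff)
      have "log_tame x0 N (\<lambda>z. p i z - p i0 z) 0"
        by (intro tame_imp_log_tame[OF _ i(2)] tame_diff p i i0)
      then have "log_tame x0 N (v i) (- \<alpha> i0 + \<alpha> i + 0)"
        unfolding v_def
        by (intro log_tame_mult log_tame_antimono[OF _ u] log_tame_antimono[OF _ Suc.prems(4)] i) auto
      then show ?thesis by simp
    qed
    have deriv: "\<forall>\<^sub>F z in corner x0. euler_deriv (\<lambda>z. u z * h i z) z (v i z)" if i: "i \<in> S" for i
      using p(2)[OF i] p(2)[OF i0] eventually_corner_positive
    proof eventually_elim
      case (elim z)
      then have "euler_deriv u z (- (h i0 z * p i0 z) * inverse (h i0 z) * inverse (h i0 z))"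
        unfolding u_def by (intro euler_deriv_inverse) auto
      then have "euler_deriv u z (- (u z * p i0 z))"
        using elim by (simp add: u_def field_simps)
      from euler_deriv_mult[OF _ this, of "h i" "h i z * p i z"] show ?case
        using elim by (simp add: v_def algebra_simps)
    qed
    have box: "\<forall>\<^sub>F z in corner x0. (\<forall>i\<in>S. euler_deriv (\<lambda>z. u z * h i z) z (v i z)) \<and>
        (\<forall>i\<in>S'. smooth_at (Suc N) (\<lambda>t. v i (on_curve z t)) (fst z)) \<and>
        smooth_at (Suc (Suc N)) (\<lambda>t. u (on_curve z t)) (fst z) \<and> h i0 z \<noteq> 0"
      using deriv v log_tame_imp_smooth_at Suc.prems(1) S'(1) u log_tame_imp_nonzero[OF Suc.prems(4)[OF i0]]
      by (intro eventually_conj eventually_ball_finite ballI) blast+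
    have inj: "inj_on (\<lambda>i. \<alpha> i - \<alpha> i0) S'"
      using Suc.prems(3) by (auto simp: inj_on_def S'_def)
    have IH: "\<forall>\<^sub>F \<delta> in at_right 0. \<forall>A x \<nu>. 0 < \<nu> \<longrightarrow> dist x x0 < \<delta> \<longrightarrow> (\<exists>i\<in>S'. A i \<noteq> 0) \<longrightarrow>
           at_most_zeros N {\<nu> / \<delta><..<\<delta>} (\<lambda>t. \<Sum>i\<in>S'. A i * v i (t, \<nu> / t, x))"
      by (rule Suc.IH[OF S'(1,2) inj v])
    from eventually_corner_boxes[OF box] eventually_at_right_less[of 0] IH
    show ?thesis
    proof eventually_elim
      case (elim \<delta>)
      show ?case
      proof (intro allI impI)
        fix A :: "'i \<Rightarrow> real" and x and \<nu> :: real
        assume \<nu>: "0 < \<nu>" and x: "dist x x0 < \<delta>" and A: "A i0 \<noteq> 0"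
        let ?I = "{\<nu> / \<delta><..<\<delta>}" and ?z = "\<lambda>t. (t, \<nu> / t, x)"
        have pos: "0 < \<nu> / \<delta>" using \<nu> elim(2) by simp
        have t: "0 < t" "t < \<delta>" "0 < \<nu> / t" "\<nu> / t < \<delta>" if "t \<in> ?I" for t
        proof -
          show "0 < t" using that pos by simp
          then show "t < \<delta>" "0 < \<nu> / t" "\<nu> / t < \<delta>"
            using that \<nu> elim(2) by (auto simp: field_simps)
        qed
        have curve: "on_curve (?z t) s = ?z s" if "t \<in> ?I" for t s
          using t[OF that] by (simp add: on_curve_def)
        note box_at = elim(1)[rule_format, OF conjI[OF t(1) conjI[OF t(2) conjI[OF t(3) conjI[OF t(4) x]]]]]
        show "at_most_zeros (Suc N) ?I (\<lambda>t. \<Sum>i\<in>S. A i * h i (?z t))"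
        proof (cases "\<exists>i\<in>S'. A i \<noteq> 0")
          case False
          then have "(\<Sum>i\<in>S. A i * h i z) = A i0 * h i0 z" for z
            unfolding S'(3) using S'(1,4) by simp
          then show ?thesis
            using box_at A by (intro at_most_zeros_nonvanishing) auto
        next
          case True
          show ?thesis
          proof (rule at_most_zeros_Suc_if_deriv)
            show "at_most_zeros N ?I (\<lambda>t. \<Sum>i\<in>S'. A i * v i (?z t))"
              using elim(3) \<nu> x True by blast
            show "smooth_at 1 (\<lambda>t. \<Sum>i\<in>S'. A i * v i (?z t)) t" if "t \<in> ?I" for t
            proof (intro smooth_at_sum S'(1) smooth_at_mult smooth_at_const)
              fix i assume "i \<in> S'"
              then have "smooth_at (Suc N) (\<lambda>s. v i (?z s)) t"
                using box_at[OF that that that that] that by (auto simp: curve)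
              then show "smooth_at 1 (\<lambda>s. v i (?z s)) t"
                by (rule smooth_at_antimono[rotated]) simp
            qed
            show "smooth_at (Suc (Suc N)) (\<lambda>t. u (?z t)) t" if "t \<in> ?I" for t
              using box_at[OF that that that that] curve[OF that] by (simp del: smooth_at.simps)
            show "((\<lambda>s. u (?z s) * (\<Sum>i\<in>S. A i * h i (?z s))) has_real_derivative
                (\<Sum>i\<in>S'. A i * v i (?z t)) / t) (at t)" if "t \<in> ?I" for t
            proof -
              have "((\<lambda>s. \<Sum>i\<in>S. A i * (u (?z s) * h i (?z s))) has_real_derivative
                  (\<Sum>i\<in>S. A i * (v i (?z t) / t))) (at t)"
                using box_at[OF that that that that]
                by (intro DERIV_sum DERIV_cmult) (auto simp: euler_deriv_def curve[OF that])
              moreover have "(\<Sum>i\<in>S. A i * (v i (?z t) / t)) = (\<Sum>i\<in>S'. A i * v i (?z t)) / t"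
                unfolding S'(3) using S'(1,4) by (simp add: v_def sum_divide_distrib)
              moreover have "(\<Sum>i\<in>S. A i * (u (?z s) * h i (?z s))) = u (?z s) * (\<Sum>i\<in>S. A i * h i (?z s))" for s
                by (simp add: sum_distrib_left mult_ac)
              ultimately show ?thesis by simp
            qed
          qed (use pos in simp)
        qed
      qed
    qed
  qed
  then have "\<forall>\<^sub>F \<delta> in at_right 0. \<forall>i0\<in>S. \<forall>A x \<nu>. 0 < \<nu> \<longrightarrow> dist x x0 < \<delta> \<longrightarrow> A i0 \<noteq> 0 \<longrightarrow>
           at_most_zeros (Suc N) {\<nu> / \<delta><..<\<delta>} (\<lambda>t. \<Sum>i\<in>S. A i * h i (t, \<nu> / t, x))"
    using Suc.prems(1) by (intro eventually_ball_finite) auto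
  then show ?case
    by eventually_elim blast
qed

section \<open>Roots on the curves\<close>

text \<open>
  All points of the curve with $\nu > 0$ have positive coordinates and lie on the graph of
  $\nu / r$. So the isolated roots are among the zeros of a function of $r$ on the open set \<open>I\<close>. It also
  contains the end points of the curve, where the multiplicities involve derivatives from both
  sides.
\<close>

lemma at_most_roots_on_curveI:
  assumes "open I" "at_most_zeros N I h" "\<And>t. t \<in> I \<Longrightarrow> smooth_at (Suc N) h t"
    and "\<And>t. t \<in> I \<Longrightarrow> f t (\<nu> / t) = h t" "0 < \<nu>"
    and "\<And>r \<rho>. 0 < r \<Longrightarrow> r \<le> r1 \<Longrightarrow> 0 < \<rho> \<Longrightarrow> \<rho> \<le> \<rho>1 \<Longrightarrow> r * \<rho> = \<nu> \<Longrightarrow> r \<in> I"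
  shows "at_most_roots_on_curve N f r1 \<rho>1 \<nu>"
proof -
  let ?f = "\<lambda>r. f r (\<nu> / r)" and ?X = "isolated_roots f (l_curve r1 \<rho>1 \<nu>)"
  let ?R = "{t \<in> I. ?f t = 0}"
  have zeros: "at_most_zeros N I ?f"
    by (rule at_most_zeros_cong[OF assms(1) _ assms(2)]) (simp add: assms(4))
  have smooth: "smooth_at (Suc N) ?f t" if "t \<in> I" for t
  proof (rule smooth_at_cong[OF _ assms(3)[OF that]])
    show "\<forall>\<^sub>F s in nhds t. h s = ?f s"
      unfolding eventually_nhds using assms(1,4) that by (intro exI[of _ I]) auto
  qed
  have on_graph: "fst q \<in> ?R \<and> q = (fst q, \<nu> / fst q)" if "q \<in> ?X" for q
  proof -
    obtain r \<rho> where q: "q = (r, \<rho>)" by (cases q)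
    then have r\<rho>: "0 \<le> r" "r \<le> r1" "0 \<le> \<rho>" "\<rho> \<le> \<rho>1" "r * \<rho> = \<nu>" "f r \<rho> = 0"
      using that by (auto simp: isolated_roots_def l_curve_def isolated_in_def)
    with assms(5) have pos: "0 < r" "0 < \<rho>" by (auto simp: less_le)
    then have "\<rho> = \<nu> / r" using r\<rho>(5) by (simp add: field_simps)
    with pos r\<rho> assms(6) q show ?thesis by auto
  qed
  have inj: "inj_on fst ?X"
  proof (rule inj_onI)
    fix p q assume *: "p \<in> ?X" "q \<in> ?X" "fst p = fst q"
    have "p = (fst q, \<nu> / fst q)" using on_graph[OF *(1)] unfolding *(3) by (rule conjunct2)
    also have "\<dots> = q" using on_graph[OF *(2)] by (metis conjunct2)
    finally show "p = q" .
  qed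
  have sub: "fst ` ?X \<subseteq> ?R" using on_graph by blast
  have fin: "finite (fst ` ?X)"
    using sum_root_multiplicity_le(1)[OF zeros smooth] sub by (rule finite_subset[rotated])
  have "(\<Sum>p\<in>?X. root_multiplicity ?f (fst p)) = (\<Sum>t\<in>fst ` ?X. root_multiplicity ?f t)"
    using inj by (simp add: sum.reindex)
  also have "\<dots> \<le> (\<Sum>t\<in>?R. root_multiplicity ?f t)"
    using sum_root_multiplicity_le(1)[OF zeros smooth] sub by (intro sum_mono2) auto
  also have "\<dots> \<le> enat N"
    by (rule sum_root_multiplicity_le(2)[OF zeros smooth])
  finally show ?thesis
    using fin inj by (simp add: at_most_roots_on_curve_def finite_image_iff)
qed

theorem theorem5p8:
  fixes V :: "real \<Rightarrow> real \<Rightarrow> 'p::euclidean_space \<Rightarrow> real"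
    and r1 \<rho>1 :: real and B :: "'p set" and x0 :: 'p
    and k l :: nat
    and A :: "nat \<Rightarrow> 'p \<Rightarrow> real"
    and J :: "'j set" and \<gamma> :: "'j \<Rightarrow> 'p \<Rightarrow> real"
    and a b :: "nat \<Rightarrow> 'p \<Rightarrow> real" and c :: "nat \<Rightarrow> 'j \<Rightarrow> 'p \<Rightarrow> real"
    and g :: "nat \<Rightarrow> real \<Rightarrow> real \<Rightarrow> 'p \<Rightarrow> real"
  assumes "0 < r1" "r1 < 1" "0 < \<rho>1"
    and "compact B" "x0 \<in> interior B"
    and "1 \<le> l" "l \<le> k"
    and "finite J"
    and "\<forall>j\<in>J. smooth_on B (\<gamma> j) \<and> \<gamma> j x0 = 0"
    and "\<forall>i\<in>{1..l}. smooth_on B (a i) \<and> smooth_on B (b i) \<and> (\<forall>j\<in>J. smooth_on B (c i j))"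
    and "\<forall>i\<in>{1..l}. Ck_on_monomials k r1 \<rho>1 B x0 (g i) \<and> order_o1 x0 (g i)"
    and "\<forall>i\<in>{1..l}. continuous_on B (A i)"
    and "\<forall>i\<in>{1..l}. \<forall>j\<in>{1..l}. i \<noteq> j \<longrightarrow> a j x0 - a i x0 - b j x0 + b i x0 \<noteq> 0"
    and "\<forall>r\<in>{0<..r1}. \<forall>\<rho>\<in>{0<..\<rho>1}. \<forall>x\<in>B.
           V r \<rho> x =
             (\<Sum>i=1..l. A i x * general_monomial_omega (a i) (b i) J \<gamma> (c i) r \<rho> x * (1 + g i r \<rho> x))"
  shows "\<exists>\<epsilon>>0. \<epsilon> \<le> r1 \<and> \<epsilon> \<le> \<rho>1 \<and> ball x0 \<epsilon> \<subseteq> B \<and>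
           (\<forall>r1' \<rho>1' B'.
              0 < r1' \<and> r1' < \<epsilon> \<and> 0 < \<rho>1' \<and> \<rho>1' < \<epsilon> \<and>
              compact B' \<and> x0 \<in> interior B' \<and> B' \<subseteq> ball x0 \<epsilon> \<longrightarrow>
              (\<forall>x\<in>B'.
                 (\<forall>\<nu>>0. at_most_roots_on_curve (l - 1) (\<lambda>r \<rho>. V r \<rho> x) r1' \<rho>1' \<nu>) \<or>
                 (\<forall>r\<in>{0<..r1'}. \<forall>\<rho>\<in>{0<..\<rho>1'}. V r \<rho> x = 0)))"
proof -
  have x0: "x0 \<in> B" using assms(5) interior_subset by blast
  obtain d where d: "d > 0" "ball x0 d \<subseteq> B"
    using assms(5) by (meson mem_interior)
  obtain N where N: "l = Suc N" using assms(6) by (cases l) auto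
  define h where "h i z = general_monomial_omega (a i) (b i) J \<gamma> (c i) (fst z) (fst (snd z)) (snd (snd z)) *
      (1 + g i (fst z) (fst (snd z)) (snd (snd z)))" for i z
  have h: "log_tame x0 N (h i) (a i x0 - b i x0)" if i: "i \<in> {1..l}" for i
  proof -
    have "tame x0 k (\<lambda>z. g i (fst z) (fst (snd z)) (snd (snd z))) 0"
      using assms(11) i assms(1,3,5) by (intro Ck_on_monomials_imp_tame[of k r1 \<rho>1 B]) auto
    then have "tame x0 (Suc N) (\<lambda>z. 1 + g i (fst z) (fst (snd z)) (snd (snd z))) (1 + 0)"
      using assms(7) N by (intro tame_add tame_const tame_antimono[of "Suc N" k]) auto
    then have "log_tame x0 N (\<lambda>z. 1 + g i (fst z) (fst (snd z)) (snd (snd z))) 0"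
      by (rule tame_imp_log_tame) simp
    then have "log_tame x0 N (h i) (a i x0 - b i x0 + 0)"
      unfolding h_def using assms(8-10) i x0
      by (intro log_tame_mult log_tame_general_monomial_omega) auto
    then show ?thesis by simp
  qed
  have inj: "inj_on (\<lambda>i. a i x0 - b i x0) {1..l}"
  proof (rule inj_onI, rule ccontr)
    fix i j assume *: "i \<in> {1..l}" "j \<in> {1..l}" "a i x0 - b i x0 = a j x0 - b j x0" "i \<noteq> j"
    then have "a j x0 - a i x0 - b j x0 + b i x0 \<noteq> 0"
      using assms(13) by blast
    with *(3) show False by simp
  qed
  have zeros: "\<forall>\<^sub>F \<delta> in at_right 0. \<forall>A x \<nu>. 0 < \<nu> \<longrightarrow> dist x x0 < \<delta> \<longrightarrow> (\<exists>i\<in>{1..l}. A i \<noteq> 0) \<longrightarrow>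
           at_most_zeros N {\<nu> / \<delta><..<\<delta>} (\<lambda>t. \<Sum>i=1..l. A i * h i (t, \<nu> / t, x))"
    using N h by (intro eventually_at_most_zeros_combination[OF _ _ inj]) auto
  have "\<forall>\<^sub>F z in corner x0. \<forall>i\<in>{1..l}. smooth_at (Suc N) (\<lambda>t. h i (on_curve z t)) (fst z)"
    using log_tame_imp_smooth_at[OF h] by (intro eventually_ball_finite) auto
  note smooth = eventually_corner_boxes[OF this]
  have "\<forall>\<^sub>F \<delta> in at_right (0::real). \<delta> \<le> r1 \<and> \<delta> \<le> \<rho>1 \<and> \<delta> \<le> d \<and> 0 < \<delta>"
    unfolding eventually_at_right_field
    by (intro exI[of _ "min d (min r1 \<rho>1)"]) (use assms d in auto)
  from eventually_happens[OF eventually_conj[OF this eventually_conj[OF zeros smooth]]]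
  obtain \<epsilon> where \<epsilon>: "0 < \<epsilon>" "\<epsilon> \<le> r1" "\<epsilon> \<le> \<rho>1" "\<epsilon> \<le> d"
    and zeros: "\<And>A x \<nu>. 0 < \<nu> \<Longrightarrow> dist x x0 < \<epsilon> \<Longrightarrow> \<exists>i\<in>{1..l}. A i \<noteq> 0 \<Longrightarrow>
           at_most_zeros N {\<nu> / \<epsilon><..<\<epsilon>} (\<lambda>t. \<Sum>i=1..l. A i * h i (t, \<nu> / t, x))"
    and smooth: "\<And>r \<rho> x i. 0 < r \<Longrightarrow> r < \<epsilon> \<Longrightarrow> 0 < \<rho> \<Longrightarrow> \<rho> < \<epsilon> \<Longrightarrow> dist x x0 < \<epsilon> \<Longrightarrow> i \<in> {1..l} \<Longrightarrow>
           smooth_at (Suc N) (\<lambda>t. h i (on_curve (r, \<rho>, x) t)) r"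
    by (auto simp: trivial_limit_at_right_real)
  have ball: "ball x0 \<epsilon> \<subseteq> B" using d \<epsilon> by (meson subset_ball subset_trans)
  have V: "V r \<rho> x = (\<Sum>i=1..l. A i x * h i (r, \<rho>, x))"
    if "0 < r" "r < \<epsilon>" "0 < \<rho>" "\<rho> < \<epsilon>" "x \<in> ball x0 \<epsilon>" for r \<rho> x
    using assms(14) that \<epsilon> ball by (auto simp: h_def mult.assoc subset_iff)
  show ?thesis
  proof (intro exI[of _ \<epsilon>] conjI allI impI ballI \<epsilon> ball)
    fix r1' \<rho>1' B' x
    assume small: "0 < r1' \<and> r1' < \<epsilon> \<and> 0 < \<rho>1' \<and> \<rho>1' < \<epsilon> \<and>
      compact B' \<and> x0 \<in> interior B' \<and> B' \<subseteq> ball x0 \<epsilon>" and "x \<in> B'"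
    then have x: "x \<in> ball x0 \<epsilon>" "dist x x0 < \<epsilon>" by (auto simp: dist_commute)
    show "(\<forall>\<nu>>0. at_most_roots_on_curve (l - 1) (\<lambda>r \<rho>. V r \<rho> x) r1' \<rho>1' \<nu>) \<or>
        (\<forall>r\<in>{0<..r1'}. \<forall>\<rho>\<in>{0<..\<rho>1'}. V r \<rho> x = 0)"
    proof (cases "\<exists>i\<in>{1..l}. A i x \<noteq> 0")
      case False
      then have "V r \<rho> x = 0" if "r \<in> {0<..r1'}" "\<rho> \<in> {0<..\<rho>1'}" for r \<rho>
        using that small x by (subst V) auto
      then show ?thesis by blast
    next
      case True
      have "at_most_roots_on_curve N (\<lambda>r \<rho>. V r \<rho> x) r1' \<rho>1' \<nu>" if \<nu>: "0 < \<nu>" for \<nu>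
      proof (rule at_most_roots_on_curveI[OF _ zeros[OF \<nu> x(2) True]])
        have pos: "0 < \<nu> / \<epsilon>" using \<nu> \<epsilon>(1) by simp
        have t: "0 < t" "t < \<epsilon>" "0 < \<nu> / t" "\<nu> / t < \<epsilon>" if "t \<in> {\<nu> / \<epsilon><..<\<epsilon>}" for t
        proof -
          show "0 < t" using that pos by simp
          then show "t < \<epsilon>" "0 < \<nu> / t" "\<nu> / t < \<epsilon>"
            using that \<nu> \<epsilon>(1) by (auto simp: field_simps)
        qed
        show "smooth_at (Suc N) (\<lambda>t. \<Sum>i=1..l. A i x * h i (t, \<nu> / t, x)) t"
          if I: "t \<in> {\<nu> / \<epsilon><..<\<epsilon>}" for t
        proof (intro smooth_at_sum smooth_at_mult smooth_at_const)
          fix i assume "i \<in> {1..l}"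
          from smooth[OF t[OF I] x(2) this] show "smooth_at (Suc N) (\<lambda>t. h i (t, \<nu> / t, x)) t"
            using t(1)[OF I] by (simp add: on_curve_def)
        qed auto
        show "V t (\<nu> / t) x = (\<Sum>i=1..l. A i x * h i (t, \<nu> / t, x))" if "t \<in> {\<nu> / \<epsilon><..<\<epsilon>}" for t
          using V[OF t[OF that] x(1)] .
        show "r \<in> {\<nu> / \<epsilon><..<\<epsilon>}" if "0 < r" "r \<le> r1'" "0 < \<rho>" "\<rho> \<le> \<rho>1'" "r * \<rho> = \<nu>" for r \<rho>
        proof -
          have "r * \<rho> < r * \<epsilon>" using that small by (intro mult_strict_left_mono) auto
          then show ?thesis
            using that small \<epsilon>(1) by (auto simp: field_simps)
        qed
      qed (use \<nu> in auto)
      then show ?thesis using N by simp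
    qed
  qed
qed

end
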